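(* Let $2<p<\infty$. Almost surely, the limit $\mathrm{GP}_p:=\lim_{n\to\infty}\mathrm{GP}_{n,p}$ exists and $$\mathrm{GP}_p=\lim_{n\to\infty}\mathrm{GP}_{n,p}=\frac p2\Bigl(\frac p2-1\Bigr)^{2/p-1}t^{2/p}L_p(t)^{1-2/p}\quad\text{for all }t>0.$$ In addition, for $\delta=p/2-1$, there exist constants $C,C'>0$ such that with probability at least $1-C'e^{-n/C'}$, if $x_*\in\mathbb{R}^n$ with $\|x_*\|_p=1$ is an optimizer of the maximization problem defining $\mathrm{GP}_{n,p}$, then $$\|x_*\|_\infty\le Cn^{\frac1{p+\delta}-\frac1p}.$$
   Context: $(g_{ij})_{i,j\ge1}$ are i.i.d. standard Gaussian random variables on one probability space, and $G_n=(g_{ij})_{i,j\in[n]}$, $[n]=\{1,\dots,n\}$. $\|x\|_p=(\sum_i|x_i|^p)^{1/p}$, $\|x\|_\infty=\max_i|x_i|$, and $|||x|||_p=\bigl(\frac1n\sum_{i\in[n]}|x_i|^p\bigr)^{1/p}$ for $x\in\mathbb{R}^n$. Define $$\mathrm{GP}_{n,p}=\max_{x\in\mathbb{R}^n:\|x\|_p=1}\frac{\langle G_nx,x\rangle}{n^{3/2-2/p}},\qquad L_{n,p}(t)=\max_{x\in\mathbb{R}^n}\Bigl(\frac{\langle G_nx,x\rangle}{n^{3/2}}-t|||x|||_p^p\Bigr),\quad t>0,$$ and let $L_p(t)$ be the deterministic almost sure limit of $L_{n,p}(t)$ as $n\to\infty$ (this limit exists almost surely, simultaneously for all $t>0$).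 The constants $C,C'$ do not depend on $n$ (they may depend on $p$). *)

theory Defs
  imports "HOL-Probability.Probability"
begin

text \<open>
  \<open>\<real>\<^sup>n\<close> is represented by the functions on the index set \<open>{1..n}\<close> that are extensional
  (equal to \<open>undefined\<close> outside \<open>{1..n}\<close>), so that the dimension can vary with \<open>n\<close>.
  Likewise a matrix of order \<open>n\<close> is given by an array of which only the entries with both
  indices in \<open>{1..n}\<close> are used.
\<close>

definition Rn :: "nat \<Rightarrow> (nat \<Rightarrow> real) set" where
  "Rn n = {1..n} \<rightarrow>\<^sub>E UNIV"

definition lp_norm :: "nat \<Rightarrow> real \<Rightarrow> (nat \<Rightarrow> real) \<Rightarrow> real" where
  "lp_norm n p x = (\<Sum>i\<in>{1..n}. \<bar>x i\<bar> powr p) powr (1 / p)"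

definition linf_norm :: "nat \<Rightarrow> (nat \<Rightarrow> real) \<Rightarrow> real" where
  "linf_norm n x = (MAX i\<in>{1..n}. \<bar>x i\<bar>)"

definition avg_lp_norm :: "nat \<Rightarrow> real \<Rightarrow> (nat \<Rightarrow> real) \<Rightarrow> real" where
  "avg_lp_norm n p x = (1 / real n * (\<Sum>i\<in>{1..n}. \<bar>x i\<bar> powr p)) powr (1 / p)"

definition quad_form :: "nat \<Rightarrow> (nat \<Rightarrow> nat \<Rightarrow> real) \<Rightarrow> (nat \<Rightarrow> real) \<Rightarrow> real" where
  "quad_form n G x = (\<Sum>i\<in>{1..n}. (\<Sum>j\<in>{1..n}. G i j * x j) * x i)"

definition GP_obj :: "nat \<Rightarrow> real \<Rightarrow> (nat \<Rightarrow> nat \<Rightarrow> real) \<Rightarrow> (nat \<Rightarrow> real) \<Rightarrow> real" where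
  "GP_obj n p G x = quad_form n G x / real n powr (3 / 2 - 2 / p)"

definition L_obj ::
  "nat \<Rightarrow> real \<Rightarrow> real \<Rightarrow> (nat \<Rightarrow> nat \<Rightarrow> real) \<Rightarrow> (nat \<Rightarrow> real) \<Rightarrow> real" where
  "L_obj n p t G x =
     quad_form n G x / real n powr (3 / 2) - t * avg_lp_norm n p x powr p"

definition lp_sphere :: "nat \<Rightarrow> real \<Rightarrow> (nat \<Rightarrow> real) set" where
  "lp_sphere n p = {x \<in> Rn n. lp_norm n p x = 1}"

text \<open>
  The two maxima are written as suprema. For \<open>n \<ge> 1\<close>, \<open>p > 2\<close>, \<open>t > 0\<close> both are attained:
  the sphere is compact, and the objective of \<open>L\<close> is continuous and tends to \<open>-\<infinity>\<close>
  at infinity.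
\<close>

definition GP :: "nat \<Rightarrow> real \<Rightarrow> (nat \<Rightarrow> nat \<Rightarrow> real) \<Rightarrow> real" where
  "GP n p G = (SUP x\<in>lp_sphere n p. GP_obj n p G x)"

definition Lmax :: "nat \<Rightarrow> real \<Rightarrow> real \<Rightarrow> (nat \<Rightarrow> nat \<Rightarrow> real) \<Rightarrow> real" where
  "Lmax n p t G = (SUP x\<in>Rn n. L_obj n p t G x)"

definition GP_optimizer ::
  "nat \<Rightarrow> real \<Rightarrow> (nat \<Rightarrow> nat \<Rightarrow> real) \<Rightarrow> (nat \<Rightarrow> real) \<Rightarrow> bool" where
  "GP_optimizer n p G x \<longleftrightarrow> is_arg_max (GP_obj n p G) (\<lambda>y. y \<in> lp_sphere n p) x"

end

theory Submission
  imports Defs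
begin

text \<open>
  Restricted to a ray, the objective of \<open>Lmax\<close> is \<open>r\<^sup>2 A - t r\<^bsup>p\<^esup>\<close>, so by Young's inequality
  \<open>Lmax\<close> is an explicit function of \<open>GP\<close> as soon as \<open>GP \<ge> 0\<close>, and the limit of one gives the limit
  of the other.

  With overwhelming probability \<open>GP\<close> is bounded below by a constant: take 1 on the first half of
  the indices and a small multiple of the signs of the row sums on the second half; Chernoff bounds
  control the three blocks. The coordinates of an optimizer satisfy
  \<open>GP n\<^bsup>3/2-2/p\<^esup> \<bar>x k\<bar>\<^bsup>p-1\<^esup> \<lesssim> \<bar>((G + G\<^sup>T) x) k\<bar>\<close>, and the right-hand side is at most a Euclidean row
  or column norm, which is \<open>O(n\<^bsup>1/2\<^esup>)\<close>, times \<open>\<parallel>x\<parallel>\<^sub>2 \<le> n\<^bsup>1/2-1/p\<^esup>\<close>. This gives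
  the exponent \<open>-(p-2)/(2p(p-1))\<close>, which is smaller than the claimed \<open>-(p-2)/(p(3p-2))\<close>.
\<close>

section \<open>Homogeneity of the quadratic form and the normalized maximum\<close>

lemma quad_form_cong:
  assumes "\<And>i. i \<in> {1..n} \<Longrightarrow> x i = y i"
  shows "quad_form n G x = quad_form n G y"
  using assms by (simp add: quad_form_def)

lemma quad_form_scale: "quad_form n G (\<lambda>i. c * x i) = c\<^sup>2 * quad_form n G x"
proof -
  have "quad_form n G (\<lambda>i. c * x i) = (\<Sum>i\<in>{1..n}. c\<^sup>2 * ((\<Sum>j\<in>{1..n}. G i j * x j) * x i))"
    unfolding quad_form_def
  proof (intro sum.cong refl)
    fix i
    have "(\<Sum>j\<in>{1..n}. G i j * (c * x j)) = c * (\<Sum>j\<in>{1..n}. G i j * x j)"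
      unfolding sum_distrib_left by (simp add: mult_ac)
    then show "(\<Sum>j\<in>{1..n}. G i j * (c * x j)) * (c * x i) =
      c\<^sup>2 * ((\<Sum>j\<in>{1..n}. G i j * x j) * x i)"
      by (simp add: power2_eq_square)
  qed
  then show ?thesis unfolding quad_form_def by (simp only: sum_distrib_left)
qed

lemma lp_norm_eq_1_iff:
  assumes "p > 0"
  shows "lp_norm n p x = 1 \<longleftrightarrow> (\<Sum>i\<in>{1..n}. \<bar>x i\<bar> powr p) = 1"
proof -
  have "0 \<le> (\<Sum>i\<in>{1..n}. \<bar>x i\<bar> powr p)" by (simp add: sum_nonneg)
  moreover have "s powr (1 / p) = 1 \<longleftrightarrow> s = 1" if "s \<ge> 0" for s :: real
  proof
    assume "s powr (1 / p) = 1"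
    then have "(s powr (1 / p)) powr p = 1" by simp
    then show "s = 1" using that assms unfolding powr_powr by simp
  qed simp
  ultimately show ?thesis unfolding lp_norm_def by blast
qed

lemma abs_le_1_of_lp_sum:
  fixes x :: "nat \<Rightarrow> real"
  assumes "p > 0" "(\<Sum>i\<in>{1..n}. \<bar>x i\<bar> powr p) = 1" "k \<in> {1..n}"
  shows "\<bar>x k\<bar> \<le> 1"
proof (rule ccontr)
  assume "\<not> \<bar>x k\<bar> \<le> 1"
  then have "\<bar>x k\<bar> powr p > 1" using assms by simp
  moreover have "\<bar>x k\<bar> powr p \<le> (\<Sum>i\<in>{1..n}. \<bar>x i\<bar> powr p)"
    using assms by (intro member_le_sum) auto
  ultimately show False using assms by simp
qed

lemma quad_form_le_sum_abs:
  assumes "\<And>i. i \<in> {1..n} \<Longrightarrow> \<bar>x i\<bar> \<le> 1"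
  shows "quad_form n G x \<le> (\<Sum>i\<in>{1..n}. \<Sum>j\<in>{1..n}. \<bar>G i j\<bar>)"
  unfolding quad_form_def sum_distrib_right
proof (intro sum_mono)
  fix i j assume "i \<in> {1..n}" "j \<in> {1..n}"
  then have "\<bar>x j\<bar> * \<bar>x i\<bar> \<le> 1 * 1" by (intro mult_mono assms) auto
  then have "\<bar>G i j\<bar> * (\<bar>x j\<bar> * \<bar>x i\<bar>) \<le> \<bar>G i j\<bar> * 1" by (intro mult_left_mono) auto
  moreover have "G i j * x j * x i \<le> \<bar>G i j * x j * x i\<bar>" by (rule abs_ge_self)
  ultimately show "G i j * x j * x i \<le> \<bar>G i j\<bar>" by (simp add: abs_mult mult.assoc)
qed

text \<open>On the sphere every coordinate is at most 1 in modulus. Boundedness is what makes the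
  supremum in \<open>GP\<close> an upper bound for the objective.\<close>

lemma bdd_above_GP_obj:
  assumes "p > 0"
  shows "bdd_above (GP_obj n p G ` lp_sphere n p)"
proof (rule bdd_aboveI2)
  fix x assume "x \<in> lp_sphere n p"
  then have "(\<Sum>i\<in>{1..n}. \<bar>x i\<bar> powr p) = 1"
    using lp_norm_eq_1_iff[OF assms] by (auto simp: lp_sphere_def)
  then have "quad_form n G x \<le> (\<Sum>i\<in>{1..n}. \<Sum>j\<in>{1..n}. \<bar>G i j\<bar>)"
    using abs_le_1_of_lp_sum[OF assms] by (intro quad_form_le_sum_abs) auto
  then show "GP_obj n p G x \<le> (\<Sum>i\<in>{1..n}. \<Sum>j\<in>{1..n}. \<bar>G i j\<bar>) / real n powr (3 / 2 - 2 / p)"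
    by (simp add: GP_obj_def divide_right_mono)
qed

lemma lp_sphere_nonempty:
  assumes "n \<ge> 1" "p > 0"
  shows "lp_sphere n p \<noteq> {}"
proof -
  define e where "e = (\<lambda>i\<in>{1..n}. if i = 1 then 1 else 0 :: real)"
  have "(\<Sum>i\<in>{1..n}. \<bar>e i\<bar> powr p) = (\<Sum>i\<in>{1..n}. if i = 1 then 1 else 0)"
    by (intro sum.cong) (auto simp: e_def)
  also have "\<dots> = 1" using assms by simp
  finally have "e \<in> lp_sphere n p"
    using assms lp_norm_eq_1_iff by (auto simp: lp_sphere_def Rn_def e_def)
  then show ?thesis by blast
qed

text \<open>Both sides are homogeneous of degree two in \<open>y\<close>, so a nonzero
  \<open>y\<close> can be rescaled to the sphere. This is the form in which the supremum is used
  throughout.\<close>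

lemma quad_form_le_GP:
  assumes "n \<ge> 1" "p > 0"
  shows "quad_form n G y \<le>
    GP n p G * real n powr (3 / 2 - 2 / p) * (\<Sum>i\<in>{1..n}. \<bar>y i\<bar> powr p) powr (2 / p)"
proof (cases "(\<Sum>i\<in>{1..n}. \<bar>y i\<bar> powr p) = 0")
  case True
  then have "\<And>i. i \<in> {1..n} \<Longrightarrow> y i = 0"
    by (subst (asm) sum_nonneg_eq_0_iff) auto
  then have "quad_form n G y = 0" by (simp add: quad_form_def)
  then show ?thesis using True by simp
next
  case False
  define P where "P = (\<Sum>i\<in>{1..n}. \<bar>y i\<bar> powr p)"
  have P: "P > 0" using False unfolding P_def by (simp add: less_le sum_nonneg)
  define s where "s = P powr (1 / p)"
  have s: "s > 0" "s powr p = P" "s\<^sup>2 = P powr (2 / p)"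
    using P assms by (auto simp: s_def powr_powr powr_power)
  define x where "x = (\<lambda>i\<in>{1..n}. (1 / s) * y i)"
  have "(\<Sum>i\<in>{1..n}. \<bar>x i\<bar> powr p) = (\<Sum>i\<in>{1..n}. \<bar>y i\<bar> powr p / P)"
    by (intro sum.cong) (auto simp: x_def abs_mult powr_mult powr_divide s abs_of_pos)
  also have "\<dots> = 1" using P by (simp add: P_def flip: sum_divide_distrib)
  finally have "x \<in> lp_sphere n p"
    using assms lp_norm_eq_1_iff by (auto simp: lp_sphere_def Rn_def x_def)
  then have "GP_obj n p G x \<le> GP n p G"
    unfolding GP_def by (intro cSUP_upper bdd_above_GP_obj assms)
  then have "quad_form n G x \<le> GP n p G * real n powr (3 / 2 - 2 / p)"
    using assms by (simp add: GP_obj_def field_simps)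
  moreover have "quad_form n G x = (1 / s)\<^sup>2 * quad_form n G y"
    by (subst quad_form_scale[symmetric], intro quad_form_cong) (auto simp: x_def)
  ultimately have "quad_form n G y / s\<^sup>2 \<le> GP n p G * real n powr (3 / 2 - 2 / p)"
    by (simp add: power_divide)
  then show ?thesis using s(1) unfolding P_def[symmetric] s(3)[symmetric]
    by (simp add: pos_divide_le_eq)
qed

lemma GP_optimizer_value:
  assumes "n \<ge> 1" "p > 0" "GP_optimizer n p G x"
  shows "quad_form n G x = GP n p G * real n powr (3 / 2 - 2 / p)"
proof -
  have x: "x \<in> lp_sphere n p" "\<And>y. y \<in> lp_sphere n p \<Longrightarrow> GP_obj n p G y \<le> GP_obj n p G x"
    using assms(3) by (auto simp: GP_optimizer_def is_arg_max_def not_less)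
  then have "GP n p G = GP_obj n p G x"
    unfolding GP_def by (intro cSup_eq_maximum) auto
  then show ?thesis using assms by (simp add: GP_obj_def)
qed

section \<open>Exact relation between the two maxima\<close>

lemma avg_lp_norm_powr:
  assumes "p > 0"
  shows "avg_lp_norm n p x powr p = (\<Sum>i\<in>{1..n}. \<bar>x i\<bar> powr p) / real n"
  using assms by (simp add: avg_lp_norm_def powr_powr sum_nonneg)

text \<open>The upper bound is the weighted Young inequality with weights \<open>2 / p\<close> and
  \<open>1 - 2 / p\<close>. The lower bound follows rays through the sphere at the radius where
  Young's inequality is an equality, and then takes the supremum over directions.\<close>

lemma Lmax_eq_GP:
  assumes n: "n \<ge> 1" and p: "p > 2" and t: "t > 0" and A: "GP n p G \<ge> 0"
  shows "Lmax n p t G =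
    (1 - 2 / p) * (GP n p G / (p * t / 2) powr (2 / p)) powr (p / (p - 2))"
proof -
  define A where "A = GP n p G"
  \<comment> \<open>\<open>r\<close> is the stationary point of
    \<open>r^2 * A - t * r powr p\<close>, that is \<open>A = (p * t / 2) * r powr (p - 2)\<close>;
    \<open>Y\<close> is the common value of \<open>r^2 * A\<close> and
    \<open>(p * t / 2) * r powr p\<close> there.\<close>
  define Y where "Y = (A / (p * t / 2) powr (2 / p)) powr (p / (p - 2))"
  define r where "r = (Y / (p * t / 2)) powr (1 / p)"
  have Y0: "Y \<ge> 0" by (simp add: Y_def)
  have pt: "p * t / 2 > 0" using p t by simp
  have rp: "r powr p = Y / (p * t / 2)" using Y0 pt p by (simp add: r_def powr_powr)
  have r0: "r \<ge> 0" by (simp add: r_def)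
  have q: "1 - 2 / p > 0" "p / (p - 2) * (1 - 2 / p) = 1" using p by (auto simp: field_simps)
  have Yq: "Y powr (1 - 2 / p) * (p * t / 2) powr (2 / p) = A"
    using A pt p t unfolding Y_def A_def powr_powr q(2) by simp
  have r2: "r\<^sup>2 = (Y / (p * t / 2)) powr (2 / p)"
    unfolding r_def by (simp flip: powr_numeral add: powr_powr)
  have r2A: "r\<^sup>2 * A = Y"
  proof (cases "Y = 0")
    case False
    then have "Y powr (2 / p) * Y powr (1 - 2 / p) = Y" using Y0 by (simp flip: powr_add)
    moreover have "(Y / (p * t / 2)) powr (2 / p) * (p * t / 2) powr (2 / p) = Y powr (2 / p)"
      using p t Y0 by (simp flip: powr_mult)
    ultimately show ?thesis unfolding r2 Yq[symmetric] by (simp add: mult_ac)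
  qed (simp add: r2)
  have upper: "L_obj n p t G x \<le> (1 - 2 / p) * Y" for x
  proof -
    define P where "P = (\<Sum>i\<in>{1..n}. \<bar>x i\<bar> powr p) / real n"
    have P0: "P \<ge> 0" by (simp add: P_def sum_nonneg)
    have "quad_form n G x \<le> A * real n powr (3 / 2 - 2 / p) * (real n * P) powr (2 / p)"
      using quad_form_le_GP[of n p G x] n p by (simp add: A_def P_def)
    also have "\<dots> = A * (real n powr (3 / 2 - 2 / p) * real n powr (2 / p)) * P powr (2 / p)"
      using P0 by (simp add: powr_mult)
    also have "real n powr (3 / 2 - 2 / p) * real n powr (2 / p) = real n powr (3 / 2)"
      by (simp flip: powr_add)
    finally have "quad_form n G x / real n powr (3 / 2) \<le> A * P powr (2 / p)"
      using n by (simp add: field_simps)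
    also have "\<dots> = (p * t / 2 * P) powr (2 / p) * Y powr (1 - 2 / p)"
      unfolding Yq[symmetric] powr_mult[of "p * t / 2" P] by (simp only: mult_ac)
    \<comment> \<open>Young's inequality is applied to \<open>p * t / 2 * P\<close> and
      \<open>Y\<close>; it asks for positive arguments, so vanishing ones are treated
      separately.\<close>
    also have "\<dots> \<le> 2 / p * (p * t / 2 * P) + (1 - 2 / p) * Y"
    proof (cases "P = 0 \<or> Y = 0")
      case True
      moreover have "0 \<le> 2 / p * (p * t / 2 * P) + (1 - 2 / p) * Y"
        using P0 Y0 p t q(1) by (intro add_nonneg_nonneg mult_nonneg_nonneg) auto
      ultimately show ?thesis by (elim disjE) simp_all
    next
      case False
      then have "P > 0" "Y > 0" using P0 Y0 by auto
      then show ?thesis using p pt q(1) by (intro Youngs_inequality_0 mult_pos_pos) simp_all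
    qed
    also have "2 / p * (p * t / 2 * P) = t * P" using p by simp
    finally show ?thesis using p by (simp add: L_obj_def avg_lp_norm_powr P_def)
  qed
  then have bdd: "bdd_above (L_obj n p t G ` Rn n)" by (intro bdd_aboveI2)
  have ne: "Rn n \<noteq> {}" by (simp add: Rn_def PiE_eq_empty_iff)
  have ray: "r\<^sup>2 * GP_obj n p G u - t * r powr p \<le> Lmax n p t G" if u: "u \<in> lp_sphere n p" for u
  proof -
    \<comment> \<open>The factor \<open>n powr (1 / p)\<close> turns a point of the unit sphere into
      a vector whose averaged norm is exactly \<open>r\<close>.\<close>
    define c where "c = r * real n powr (1 / p)"
    define x where "x = (\<lambda>i\<in>{1..n}. c * u i)"
    have c0: "c \<ge> 0" using r0 by (simp add: c_def)
    have cp: "c powr p = r powr p * real n" using r0 p n by (simp add: c_def powr_mult powr_powr)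
    have c2: "c\<^sup>2 = r\<^sup>2 * real n powr (2 / p)"
      using n by (simp add: c_def power_mult_distrib powr_power)
    have u1: "(\<Sum>i\<in>{1..n}. \<bar>u i\<bar> powr p) = 1"
      using u p lp_norm_eq_1_iff by (auto simp: lp_sphere_def)
    have "quad_form n G x = c\<^sup>2 * quad_form n G u"
      by (subst quad_form_scale[symmetric], intro quad_form_cong) (auto simp: x_def)
    moreover have "quad_form n G u = GP_obj n p G u * real n powr (3 / 2 - 2 / p)"
      using n by (simp add: GP_obj_def)
    moreover have "real n powr (3 / 2) = real n powr (2 / p) * real n powr (3 / 2 - 2 / p)"
      by (simp flip: powr_add)
    ultimately have "quad_form n G x / real n powr (3 / 2) = r\<^sup>2 * GP_obj n p G u"
      using n by (simp add: c2)
    moreover have "(\<Sum>i\<in>{1..n}. \<bar>x i\<bar> powr p) = (\<Sum>i\<in>{1..n}. c powr p * \<bar>u i\<bar> powr p)"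
      using c0 by (intro sum.cong) (auto simp: x_def abs_mult powr_mult)
    then have "(\<Sum>i\<in>{1..n}. \<bar>x i\<bar> powr p) = c powr p"
      using u1 by (simp flip: sum_distrib_left)
    ultimately have "L_obj n p t G x = r\<^sup>2 * GP_obj n p G u - t * r powr p"
      using p n by (simp add: L_obj_def avg_lp_norm_powr cp)
    moreover have "x \<in> Rn n" by (simp add: x_def Rn_def)
    ultimately show ?thesis
      unfolding Lmax_def using cSUP_upper[OF _ bdd, of x] by simp
  qed
  have "r\<^sup>2 * A - t * r powr p \<le> Lmax n p t G"
  \<comment> \<open>For \<open>r = 0\<close> the left-hand side is 0 and any one point of the sphere
    suffices; otherwise \<open>ray\<close> is divided by \<open>r^2\<close> so that the supremum
    over \<open>u\<close> can be taken.\<close>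
  proof (cases "r = 0")
    case True
    moreover obtain u where "u \<in> lp_sphere n p" using lp_sphere_nonempty[of n p] n p by auto
    ultimately show ?thesis using ray[of u] by simp
  next
    case False
    then have "GP_obj n p G u \<le> (Lmax n p t G + t * r powr p) / r\<^sup>2" if "u \<in> lp_sphere n p" for u
      using ray[OF that] by (simp add: field_simps)
    then have "A \<le> (Lmax n p t G + t * r powr p) / r\<^sup>2"
      unfolding A_def GP_def using lp_sphere_nonempty[of n p] n p by (intro cSUP_least) auto
    then show ?thesis using False by (simp add: field_simps)
  qed
  also have "r\<^sup>2 * A - t * r powr p = (1 - 2 / p) * Y"
    using p t unfolding rp r2A by (simp add: field_simps)
  finally have "(1 - 2 / p) * Y \<le> Lmax n p t G" .
  moreover have "Lmax n p t G \<le> (1 - 2 / p) * Y"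
    unfolding Lmax_def using ne upper by (intro cSUP_least)
  ultimately show ?thesis by (simp add: Y_def A_def)
qed

text \<open>Raising the formula of \<open>Lmax_eq_GP\<close> to the power \<open>1 - 2 / p\<close>,
  the reciprocal of \<open>p / (p - 2)\<close>, makes it linear in \<open>GP\<close>. The rest is
  bookkeeping of constants, using \<open>p / 2 - 1 = q * (p / 2)\<close>.\<close>

lemma GP_eq_Lmax:
  assumes "n \<ge> 1" "p > 2" "t > 0" "GP n p G \<ge> 0"
  shows "GP n p G = p / 2 * (p / 2 - 1) powr (2 / p - 1) * t powr (2 / p) *
    Lmax n p t G powr (1 - 2 / p)"
proof -
  define A where "A = GP n p G"
  define q where "q = 1 - 2 / p"
  have q: "q > 0" "2 / p - 1 = - q" "2 / p = 1 - q" "p / (p - 2) * q = 1" "p / 2 - 1 = q * (p / 2)"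
    using assms by (auto simp: q_def field_simps)
  have "Lmax n p t G powr q = q powr q * (A / (p * t / 2) powr (1 - q))"
    using assms q unfolding Lmax_eq_GP[OF assms]
    by (simp add: powr_mult powr_powr flip: A_def q_def)
  moreover have "(p * t / 2) powr (1 - q) = (p / 2) powr (1 - q) * t powr (1 - q)"
    using assms by (simp flip: powr_mult)
  moreover have "(p / 2 - 1) powr (- q) = inverse (q powr q) * inverse ((p / 2) powr q)"
    unfolding q(5) using q(1) assms powr_mult[of q "p / 2" q] by (simp add: powr_minus)
  moreover have pq: "(p / 2) powr (1 - q) * (p / 2) powr q = p / 2"
    using assms by (simp flip: powr_add)
  ultimately have "p / 2 * (p / 2 - 1) powr (- q) * t powr (1 - q) * Lmax n p t G powr q =
    (p / 2) * (inverse (q powr q) * inverse ((p / 2) powr q)) * t powr (1 - q) *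
      (q powr q * (A / ((p / 2) powr (1 - q) * t powr (1 - q))))"
    by simp
  also have "\<dots> = (p / 2) / ((p / 2) powr (1 - q) * (p / 2) powr q) * A"
    using assms q(1) by (simp add: divide_simps)
  also have "\<dots> = A" unfolding pq using assms by simp
  finally show ?thesis by (simp add: A_def q_def)
qed

section \<open>Lower bound for the normalized maximum from one test vector\<close>

text \<open>Entries of modulus at most 1 have \<open>p\<close>-th powers summing to at most
  \<open>n\<close>, so normalizing \<open>y\<close> costs at most \<open>n powr (2 / p)\<close>,
  which cancels against the scaling in \<open>GP\<close>.\<close>

lemma GP_ge_of_vector:
  assumes n: "n \<ge> 1" and p: "p > 0" and c: "c > 0"
    and y: "\<And>i. i \<in> {1..n} \<Longrightarrow> \<bar>y i\<bar> \<le> 1" and Q: "c * real n powr (3 / 2) \<le> quad_form n G y"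
  shows "c \<le> GP n p G"
proof -
  define P where "P = (\<Sum>i\<in>{1..n}. \<bar>y i\<bar> powr p)"
  have P: "P \<ge> 0" "P \<le> real n"
  proof -
    show "P \<ge> 0" by (simp add: P_def sum_nonneg)
    have "\<bar>y i\<bar> powr p \<le> 1" if "i \<in> {1..n}" for i
      using powr_mono2[of p "\<bar>y i\<bar>" 1] y[OF that] p by simp
    then have "P \<le> (\<Sum>i\<in>{1..n}. 1)" unfolding P_def by (intro sum_mono)
    then show "P \<le> real n" by simp
  qed
  have pos: "0 < c * real n powr (3 / 2)" using n c by simp
  have le: "c * real n powr (3 / 2) \<le> GP n p G * (real n powr (3 / 2 - 2 / p) * P powr (2 / p))"
    using Q quad_form_le_GP[OF n p, of G y] by (simp add: P_def mult.assoc)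
  \<comment> \<open>The sign has to be settled first: replacing \<open>P\<close> by the larger
    \<open>n\<close> increases the right-hand side only if \<open>GP\<close> is nonnegative.\<close>
  have "GP n p G \<ge> 0"
  proof (rule ccontr)
    assume "\<not> GP n p G \<ge> 0"
    then have "GP n p G * (real n powr (3 / 2 - 2 / p) * P powr (2 / p)) \<le> 0"
      by (intro mult_nonpos_nonneg) simp_all
    then show False using pos le by linarith
  qed
  moreover have "real n powr (3 / 2 - 2 / p) * P powr (2 / p) \<le>
      real n powr (3 / 2 - 2 / p) * real n powr (2 / p)"
    using P p by (intro mult_left_mono powr_mono2) simp_all
  ultimately have "GP n p G * (real n powr (3 / 2 - 2 / p) * P powr (2 / p)) \<le>
      GP n p G * (real n powr (3 / 2 - 2 / p) * real n powr (2 / p))"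
    by (metis mult_left_mono)
  also have "real n powr (3 / 2 - 2 / p) * real n powr (2 / p) = real n powr (3 / 2)"
    by (simp flip: powr_add)
  finally have "c * real n powr (3 / 2) \<le> GP n p G * real n powr (3 / 2)" using le by linarith
  then show ?thesis using n by simp
qed

section \<open>Sup norm of optimizers, deterministic part\<close>

text \<open>Concavity, obtained as Young's inequality with second argument 1. It serves both the
  comparison of norms and the expansion of \<open>(1 - a) powr (2 / p)\<close>.\<close>

lemma powr_le_tangent_at_1:
  fixes a \<alpha> :: real
  assumes "a \<ge> 0" "0 < \<alpha>" "\<alpha> \<le> 1"
  shows "a powr \<alpha> \<le> 1 + \<alpha> * (a - 1)"
proof (cases "a = 0")
  case False
  then show ?thesis using Youngs_inequality_0[of \<alpha> "1 - \<alpha>" a 1] assms by (simp add: algebra_simps)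
qed (use assms in simp)

text \<open>This is the power mean inequality: the numbers \<open>n * \<bar>x i\<bar> powr p\<close>
  have average 1, so the linear terms of the tangent bounds at 1 cancel on summation.\<close>

lemma sum_squares_le_of_lp_sum:
  fixes x :: "nat \<Rightarrow> real"
  assumes p: "p > 2" and x: "(\<Sum>i\<in>{1..n}. \<bar>x i\<bar> powr p) = 1"
  shows "(\<Sum>i\<in>{1..n}. (x i)\<^sup>2) \<le> real n powr (1 - 2 / p)"
proof -
  have n: "n \<ge> 1" using x by (cases n) auto
  have "real n powr (2 / p) * (x i)\<^sup>2 \<le> 1 + 2 / p * (real n * \<bar>x i\<bar> powr p - 1)" for i
  proof -
    have "(x i)\<^sup>2 = (\<bar>x i\<bar> powr p) powr (2 / p)"
      using p by (simp add: powr_powr)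
    then have "real n powr (2 / p) * (x i)\<^sup>2 = (real n * \<bar>x i\<bar> powr p) powr (2 / p)"
      by (simp add: powr_mult)
    then show ?thesis using powr_le_tangent_at_1[of "real n * \<bar>x i\<bar> powr p" "2 / p"] p by simp
  qed
  then have "(\<Sum>i\<in>{1..n}. real n powr (2 / p) * (x i)\<^sup>2) \<le>
    (\<Sum>i\<in>{1..n}. 1 + 2 / p * (real n * \<bar>x i\<bar> powr p - 1))" by (intro sum_mono)
  also have "\<dots> = real n + 2 / p * (real n * (\<Sum>i\<in>{1..n}. \<bar>x i\<bar> powr p) - real n)"
    unfolding sum.distrib sum_distrib_left[symmetric] sum_subtractf by simp
  also have "\<dots> = real n" using x by simp
  finally have "real n powr (2 / p) * (\<Sum>i\<in>{1..n}. (x i)\<^sup>2) \<le> real n"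
    by (simp add: sum_distrib_left)
  also have "real n = real n powr (2 / p) * real n powr (1 - 2 / p)"
    using n by (simp flip: powr_add)
  finally show ?thesis using n by simp
qed

lemma abs_sum_mult_le_sqrt:
  fixes a b :: "nat \<Rightarrow> real"
  assumes "(\<Sum>i\<in>I. (a i)\<^sup>2) \<le> R" "(\<Sum>i\<in>I. (b i)\<^sup>2) \<le> S"
  shows "\<bar>\<Sum>i\<in>I. a i * b i\<bar> \<le> sqrt R * sqrt S"
proof -
  have R: "R \<ge> 0" using assms(1) sum_nonneg[of I "\<lambda>i. (a i)\<^sup>2"] by fastforce
  have "(\<Sum>i\<in>I. a i * b i)\<^sup>2 \<le> (\<Sum>i\<in>I. (a i)\<^sup>2) * (\<Sum>i\<in>I. (b i)\<^sup>2)"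
    by (rule Cauchy_Schwarz_ineq_sum)
  also have "\<dots> \<le> R * S" using assms R by (intro mult_mono sum_nonneg) auto
  finally have "sqrt ((\<Sum>i\<in>I. a i * b i)\<^sup>2) \<le> sqrt (R * S)" by (rule real_sqrt_le_mono)
  then show ?thesis by (simp add: real_sqrt_mult)
qed

text \<open>The row sum and the column sum both contain the diagonal entry, which is therefore
  subtracted twice and has to be added back once.\<close>

lemma quad_form_zero_coordinate:
  assumes k: "k \<in> {1..n}"
  shows "quad_form n G (x(k := 0)) = quad_form n G x -
    x k * ((\<Sum>j\<in>{1..n}. G k j * x j) + (\<Sum>j\<in>{1..n}. G j k * x j)) + G k k * (x k)\<^sup>2"
proof -
  define I where "I = {1..n} - {k}"
  have split: "(\<Sum>i\<in>{1..n}. f i) = f k + (\<Sum>i\<in>I. f i)" for f :: "nat \<Rightarrow> real"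
    unfolding I_def by (rule sum.remove) (use k in auto)
  have kI: "k \<notin> I" by (simp add: I_def)
  have y: "(\<Sum>j\<in>I. f j * (x(k := 0)) j) = (\<Sum>j\<in>I. f j * x j)" for f
    using kI by (intro sum.cong) auto
  have "quad_form n G (x(k := 0)) = (\<Sum>i\<in>I. (\<Sum>j\<in>I. G i j * x j) * x i)"
    unfolding quad_form_def split y by simp
  moreover have "quad_form n G x = (G k k * x k + (\<Sum>j\<in>I. G k j * x j)) * x k +
      (\<Sum>i\<in>I. G i k * x i) * x k + (\<Sum>i\<in>I. (\<Sum>j\<in>I. G i j * x j) * x i)"
    unfolding quad_form_def split
    by (simp add: distrib_right distrib_left sum.distrib sum_distrib_right sum_distrib_left mult_ac)
  ultimately show ?thesis unfolding split by (simp add: power2_eq_square algebra_simps)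
qed

text \<open>Zeroing the coordinate \<open>k\<close> changes the quadratic form at first order by \<open>x k\<close> times
  \<open>((G + G\<^sup>T) x) k\<close> and scales \<open>\<parallel>x\<parallel>\<^sub>p\<^sup>2\<close> by \<open>(1 - \<bar>x k\<bar>\<^bsup>p\<^esup>)\<^bsup>2/p\<^esup>\<close>; this gives one half of
  the Lagrange equation without differentiating.\<close>

lemma GP_optimizer_coordinate:
  assumes n: "n \<ge> 1" and p: "p > 2" and opt: "GP_optimizer n p G x" and k: "k \<in> {1..n}"
    and A: "quad_form n G x \<ge> 0"
    and row: "(\<Sum>j\<in>{1..n}. (G k j)\<^sup>2) \<le> R" and col: "(\<Sum>j\<in>{1..n}. (G j k)\<^sup>2) \<le> R"
  shows "2 * quad_form n G x / p * \<bar>x k\<bar> powr (p - 1) \<le> 3 * sqrt R * sqrt (real n powr (1 - 2 / p))"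
proof (cases "x k = 0")
  case True
  have "R \<ge> 0" using row sum_nonneg[of "{1..n}" "\<lambda>j. (G k j)\<^sup>2"] by fastforce
  then show ?thesis using True by simp
next
  case False
  define A where "A = quad_form n G x"
  define S where "S = real n powr (1 - 2 / p)"
  define B where "B = (\<Sum>j\<in>{1..n}. G k j * x j) + (\<Sum>j\<in>{1..n}. G j k * x j)"
  define a where "a = \<bar>x k\<bar> powr p"
  have p0: "p > 0" using p by simp
  have x1: "(\<Sum>i\<in>{1..n}. \<bar>x i\<bar> powr p) = 1"
    using opt lp_norm_eq_1_iff[OF p0] by (auto simp: GP_optimizer_def is_arg_max_def lp_sphere_def)
  have xS: "(\<Sum>i\<in>{1..n}. (x i)\<^sup>2) \<le> S"
    unfolding S_def by (rule sum_squares_le_of_lp_sum[OF p x1])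
  \<comment> \<open>Row and column give one Cauchy-Schwarz bound each; the diagonal term bounded in
    \<open>Gk\<close> adds a third, whence the factor 3.\<close>
  have B: "\<bar>B\<bar> \<le> 2 * (sqrt R * sqrt S)"
    using abs_sum_mult_le_sqrt[OF row xS] abs_sum_mult_le_sqrt[OF col xS] unfolding B_def by linarith
  have "(G k k)\<^sup>2 \<le> (\<Sum>j\<in>{1..n}. (G k j)\<^sup>2)" "(x k)\<^sup>2 \<le> (\<Sum>i\<in>{1..n}. (x i)\<^sup>2)"
    using k by (auto intro!: member_le_sum)
  then have "(G k k)\<^sup>2 \<le> R" "(x k)\<^sup>2 \<le> S" using row xS by auto
  then have Gk: "\<bar>G k k\<bar> * \<bar>x k\<bar> \<le> sqrt R * sqrt S"
    using order_trans[OF zero_le_power2, of "G k k" R]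
    by (intro mult_mono) (auto intro: real_le_rsqrt)
  have a1: "0 \<le> a" "a \<le> 1"
    using abs_le_1_of_lp_sum[OF p0 x1 k] powr_mono2[of p "\<bar>x k\<bar>" 1] p by (auto simp: a_def)
  have "(\<Sum>i\<in>{1..n}. \<bar>(x(k := 0)) i\<bar> powr p) = (\<Sum>i\<in>{1..n} - {k}. \<bar>x i\<bar> powr p)"
    using k p by (subst sum.remove[of _ k]) (auto intro!: sum.cong)
  also have "\<dots> = 1 - a" using x1 k by (subst (asm) sum.remove[of _ k]) (auto simp: a_def)
  finally have y: "(\<Sum>i\<in>{1..n}. \<bar>(x(k := 0)) i\<bar> powr p) = 1 - a" .
  have "A - x k * B + G k k * (x k)\<^sup>2 = quad_form n G (x(k := 0))"
    unfolding A_def B_def quad_form_zero_coordinate[OF k] ..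
  \<comment> \<open>Optimality enters here: \<open>GP\<close> times its power of \<open>n\<close>
    equals \<open>A\<close>, so the homogeneous bound for the truncated vector is expressed through
    \<open>A\<close> itself.\<close>
  also have "\<dots> \<le> A * (1 - a) powr (2 / p)"
    using quad_form_le_GP[OF n p0, of G "x(k := 0)"] GP_optimizer_value[OF n p0 opt]
    by (simp only: y A_def)
  also have "\<dots> \<le> A * (1 + 2 / p * (1 - a - 1))"
    using a1 p A by (intro mult_left_mono powr_le_tangent_at_1) (auto simp: A_def)
  finally have "2 * A / p * a \<le> x k * B - G k k * (x k)\<^sup>2"
    by (simp add: algebra_simps)
  also have "\<dots> \<le> \<bar>x k * B\<bar> + \<bar>G k k * (x k)\<^sup>2\<bar>" by linarith
  also have "\<dots> = \<bar>x k\<bar> * (\<bar>B\<bar> + \<bar>G k k\<bar> * \<bar>x k\<bar>)"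
    by (simp add: abs_mult power2_eq_square algebra_simps)
  also have "\<dots> \<le> \<bar>x k\<bar> * (3 * sqrt R * sqrt S)"
    using B Gk by (intro mult_left_mono) linarith+
  also have "a = \<bar>x k\<bar> * \<bar>x k\<bar> powr (p - 1)"
    using False by (simp add: a_def powr_diff)
  finally have "\<bar>x k\<bar> * (2 * A / p * \<bar>x k\<bar> powr (p - 1)) \<le> \<bar>x k\<bar> * (3 * sqrt R * sqrt S)"
    by (simp add: mult_ac)
  then have "2 * A / p * \<bar>x k\<bar> powr (p - 1) \<le> 3 * sqrt R * sqrt S"
    by (rule mult_left_le_imp_le) (use False in simp)
  then show ?thesis by (simp only: A_def S_def)
qed

text \<open>With \<open>R = \<rho> * n\<close> in the coordinate bound, the powers of
  \<open>n\<close> combine to \<open>1/2 + e - (3/2 - 2/p) = - e\<close>, and taking the root of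
  order \<open>p - 1\<close> gives the exponent \<open>- e / (p - 1)\<close>.\<close>

lemma GP_optimizer_linf_le:
  assumes n: "n \<ge> 1" and p: "p > 2" and c: "c > 0" and \<rho>: "\<rho> \<ge> 0"
    and row: "\<And>k. k \<in> {1..n} \<Longrightarrow> (\<Sum>j\<in>{1..n}. (G k j)\<^sup>2) \<le> \<rho> * real n"
    and col: "\<And>k. k \<in> {1..n} \<Longrightarrow> (\<Sum>j\<in>{1..n}. (G j k)\<^sup>2) \<le> \<rho> * real n"
    and GP: "c \<le> GP n p G" and opt: "GP_optimizer n p G x"
  shows "linf_norm n x \<le>
    (3 * p * sqrt \<rho> / (2 * c)) powr (1 / (p - 1)) * real n powr (1 / (p + (p / 2 - 1)) - 1 / p)"
proof -
  define K where "K = 3 * p * sqrt \<rho> / (2 * c)"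
  define e where "e = 1 / 2 - 1 / p"
  have K: "K \<ge> 0" using p c \<rho> by (simp add: K_def)
  have N: "real n > 0" using n by simp
  have A: "c * real n powr (3 / 2 - 2 / p) \<le> quad_form n G x"
    using GP_optimizer_value[OF n _ opt] GP p by (simp add: mult_right_mono)
  moreover have "0 \<le> c * real n powr (3 / 2 - 2 / p)" using c by simp
  ultimately have A0: "quad_form n G x \<ge> 0" by linarith
  \<comment> \<open>Both exponents are negative multiples of \<open>p - 2\<close>; the comparison
    reduces to \<open>2 * (p - 1) \<le> 3 * p - 2\<close>.\<close>
  have expo: "- e / (p - 1) \<le> 1 / (p + (p / 2 - 1)) - 1 / p"
  proof -
    have "- e / (p - 1) = - ((p - 2) / (2 * p * (p - 1)))" using p by (simp add: e_def divide_simps)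
    moreover have "1 / (p + (p / 2 - 1)) - 1 / p = - ((p - 2) / (p * (3 * p - 2)))"
      using p by (simp add: divide_simps)
    moreover have "(p - 2) / (p * (3 * p - 2)) \<le> (p - 2) / (2 * p * (p - 1))"
      using p by (intro divide_left_mono mult_pos_pos) (auto simp: algebra_simps)
    ultimately show ?thesis by linarith
  qed
  have "\<bar>x k\<bar> \<le> K powr (1 / (p - 1)) * real n powr (1 / (p + (p / 2 - 1)) - 1 / p)"
    if k: "k \<in> {1..n}" for k
  proof -
    have "2 * (c * real n powr (3 / 2 - 2 / p)) / p * \<bar>x k\<bar> powr (p - 1) \<le>
        2 * quad_form n G x / p * \<bar>x k\<bar> powr (p - 1)"
      using A p by (intro mult_right_mono divide_right_mono) auto
    also have "\<dots> \<le> 3 * sqrt (\<rho> * real n) * sqrt (real n powr (1 - 2 / p))"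
      by (rule GP_optimizer_coordinate[OF n p opt k A0 row[OF k] col[OF k]])
    also have "sqrt (\<rho> * real n) = sqrt \<rho> * real n powr (1 / 2)"
      using N by (simp add: real_sqrt_mult powr_half_sqrt)
    also have "sqrt (real n powr (1 - 2 / p)) = real n powr e"
      using N by (simp add: powr_half_sqrt[symmetric] powr_powr e_def diff_divide_distrib)
    finally have 1: "2 * (c * real n powr (3 / 2 - 2 / p)) / p * \<bar>x k\<bar> powr (p - 1) \<le>
      3 * sqrt \<rho> * (real n powr (1 / 2) * real n powr e)" by (simp only: mult.assoc)
    have 2: "real n powr (1 / 2) * real n powr e = real n powr (3 / 2 - 2 / p) * real n powr (- e)"
      unfolding powr_add[symmetric] e_def by (rule arg_cong[where f = "(powr) (real n)"]) simp
    have "real n powr (3 / 2 - 2 / p) * (2 * c / p * \<bar>x k\<bar> powr (p - 1)) \<le>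
      real n powr (3 / 2 - 2 / p) * (3 * sqrt \<rho> * real n powr (- e))"
      using 1 unfolding 2 by (simp add: mult_ac)
    then have "2 * c / p * \<bar>x k\<bar> powr (p - 1) \<le> 3 * sqrt \<rho> * real n powr (- e)"
      by (rule mult_left_le_imp_le) (use N in simp)
    then have "\<bar>x k\<bar> powr (p - 1) \<le> K * real n powr (- e)"
      using c p unfolding K_def by (simp add: field_simps)
    then have "(\<bar>x k\<bar> powr (p - 1)) powr (1 / (p - 1)) \<le> (K * real n powr (- e)) powr (1 / (p - 1))"
      using p by (intro powr_mono2) auto
    also have "(\<bar>x k\<bar> powr (p - 1)) powr (1 / (p - 1)) = \<bar>x k\<bar>" using p by (simp add: powr_powr)
    also have "(K * real n powr (- e)) powr (1 / (p - 1)) = K powr (1 / (p - 1)) * real n powr (- e / (p - 1))"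
      by (simp add: powr_mult powr_powr)
    also have "\<dots> \<le> K powr (1 / (p - 1)) * real n powr (1 / (p + (p / 2 - 1)) - 1 / p)"
      using n expo by (intro mult_left_mono powr_mono) auto
    finally show ?thesis .
  qed
  then show ?thesis unfolding linf_norm_def K_def[symmetric] using n by (subst Max_le_iff) auto
qed

section \<open>Measurability of the event about all optimizers\<close>

text \<open>Projection along a compact factor is a closed map; the tube lemma shows that the
  complement of the image is open.\<close>

lemma closed_exists_compact:
  assumes "compact K" "closed T"
  shows "closed {y. \<exists>x\<in>K. (y, x) \<in> T}"
proof -
  have "open {y. \<forall>x\<in>K. (y, x) \<notin> T}"
  proof (subst open_subopen, intro ballI)
    fix y assume "y \<in> {y. \<forall>x\<in>K. (y, x) \<notin> T}"
    then have "{y} \<times> K \<subseteq> - T" by auto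
    then obtain U where "y \<in> U" "open U" "U \<times> K \<subseteq> - T"
      using Elementary_Topology.tube_lemma[OF assms(1), of "- T" y] assms(2) by (auto simp: open_Compl)
    then show "\<exists>U. open U \<and> y \<in> U \<and> U \<subseteq> {y. \<forall>x\<in>K. (y, x) \<notin> T}" by blast
  qed
  moreover have "- {y. \<exists>x\<in>K. (y, x) \<in> T} = {y. \<forall>x\<in>K. (y, x) \<notin> T}" by auto
  ultimately show ?thesis by (simp add: closed_def)
qed

lemma continuous_on_GP_obj:
  assumes G: "continuous_on S G" and x: "continuous_on S x"
  shows "continuous_on S (\<lambda>z. GP_obj n p (G z) (x z))"
proof -
  have "continuous_on S (\<lambda>z. G z i j)" for i j
    using continuous_on_product_then_coordinatewise[OF continuous_on_product_then_coordinatewise[OF G]] .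
  moreover have "continuous_on S (\<lambda>z. x z i)" for i
    using continuous_on_product_then_coordinatewise[OF x] .
  ultimately show ?thesis
    unfolding GP_obj_def quad_form_def divide_inverse
    by (intro continuous_on_mult continuous_on_sum continuous_on_const) simp_all
qed

text \<open>The topology on sequences is the product topology. Coordinates outside
  \<open>{1..n}\<close> are frozen at \<open>undefined\<close>, so the set is a closed part of a
  product of intervals and singletons, which is compact by Tychonoff.\<close>

lemma compact_lp_sphere_part:
  assumes p: "p > 0"
  shows "compact {x \<in> lp_sphere n p. c \<le> \<bar>x k\<bar>}"
proof -
  define X where "X i = (if i \<in> {1..n} then {-1..1} else {undefined :: real})" for i
  have "compactin (product_topology (\<lambda>i. euclidean) UNIV) (PiE UNIV X)"
    unfolding compactin_PiE by (auto simp: X_def)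
  then have "compact (PiE UNIV X)"
    unfolding euclidean_product_topology by simp
  moreover have "closed {x :: nat \<Rightarrow> real. (\<Sum>i\<in>{1..n}. \<bar>x i\<bar> powr p) = 1 \<and> c \<le> \<bar>x k\<bar>}"
    using p by (intro closed_Collect_conj closed_Collect_eq closed_Collect_le continuous_intros
        continuous_on_powr' continuous_on_product_coordinates) auto
  ultimately have "compact (PiE UNIV X \<inter>
      {x :: nat \<Rightarrow> real. (\<Sum>i\<in>{1..n}. \<bar>x i\<bar> powr p) = 1 \<and> c \<le> \<bar>x k\<bar>})"
    by (rule compact_Int_closed)
  also have "\<dots> = {x \<in> lp_sphere n p. c \<le> \<bar>x k\<bar>}"
  proof (intro set_eqI iffI)
    fix x assume "x \<in> PiE UNIV X \<inter>
      {x :: nat \<Rightarrow> real. (\<Sum>i\<in>{1..n}. \<bar>x i\<bar> powr p) = 1 \<and> c \<le> \<bar>x k\<bar>}"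
    then have x: "\<And>i. x i \<in> X i" "(\<Sum>i\<in>{1..n}. \<bar>x i\<bar> powr p) = 1" "c \<le> \<bar>x k\<bar>" by auto
    have "x i = undefined" if "i \<notin> {1..n}" for i
      using x(1)[of i] that by (simp only: X_def if_False singleton_iff)
    then have "x \<in> Rn n" unfolding Rn_def by (intro PiE_I) auto
    then show "x \<in> {x \<in> lp_sphere n p. c \<le> \<bar>x k\<bar>}"
      using x lp_norm_eq_1_iff[OF p] by (simp add: lp_sphere_def)
  next
    fix x assume x: "x \<in> {x \<in> lp_sphere n p. c \<le> \<bar>x k\<bar>}"
    then have x1: "(\<Sum>i\<in>{1..n}. \<bar>x i\<bar> powr p) = 1"
      using lp_norm_eq_1_iff[OF p] by (simp add: lp_sphere_def)
    have "x i \<in> X i" for i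
    proof (cases "i \<in> {1..n}")
      case True
      then show ?thesis using abs_le_1_of_lp_sum[OF p x1 True] by (auto simp: X_def)
    next
      case False
      have "x \<in> PiE {1..n} (\<lambda>_. UNIV)" using x by (simp add: lp_sphere_def Rn_def)
      then have "x i = undefined" using False by (rule PiE_arb)
      then show ?thesis unfolding X_def if_not_P[OF False] by (simp only: singleton_iff)
    qed
    then have "x \<in> PiE UNIV X" by (intro PiE_I) simp_all
    then show "x \<in> PiE UNIV X \<inter>
      {x :: nat \<Rightarrow> real. (\<Sum>i\<in>{1..n}. \<bar>x i\<bar> powr p) = 1 \<and> c \<le> \<bar>x k\<bar>}"
      using x x1 by simp
  qed
  finally show ?thesis .
qed

text \<open>Optimality is an intersection, over competitors \<open>y\<close>, of conditions closed
  jointly in the array and the point; the witness is then projected out along the compact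
  set.\<close>

lemma closed_GP_optimizer_part:
  assumes "p > 0"
  shows "closed {G. \<exists>x. GP_optimizer n p G x \<and> c \<le> \<bar>x k\<bar>}"
proof -
  define T where "T = {z. \<forall>y\<in>lp_sphere n p. GP_obj n p (fst z) y \<le> GP_obj n p (fst z) (snd z)}"
  have "T = (\<Inter>y\<in>lp_sphere n p. {z. GP_obj n p (fst z) y \<le> GP_obj n p (fst z) (snd z)})"
    by (auto simp: T_def)
  also have "closed \<dots>"
    by (intro closed_INT ballI closed_Collect_le continuous_on_GP_obj
        continuous_on_fst continuous_on_snd continuous_on_const continuous_on_id)
  finally have "closed T" .
  then have "closed {G. \<exists>x\<in>{x \<in> lp_sphere n p. c \<le> \<bar>x k\<bar>}. (G, x) \<in> T}"
    by (intro closed_exists_compact compact_lp_sphere_part assms)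
  also have "{G. \<exists>x\<in>{x \<in> lp_sphere n p. c \<le> \<bar>x k\<bar>}. (G, x) \<in> T} =
      {G. \<exists>x. GP_optimizer n p G x \<and> c \<le> \<bar>x k\<bar>}"
    by (auto simp: T_def GP_optimizer_def is_arg_max_def not_less)
  finally show ?thesis .
qed

text \<open>Compactness makes the set of arrays having an optimizer with \<open>\<bar>x k\<bar> \<ge> c\<close> closed, so the
  uncountable quantifier over optimizers does not spoil measurability.\<close>

lemma sets_GP_optimizer_linf:
  fixes g :: "nat \<Rightarrow> nat \<Rightarrow> 'a \<Rightarrow> real"
  assumes n: "n \<ge> 1" and p: "p > 0"
    and g: "\<And>i j. i \<ge> 1 \<Longrightarrow> j \<ge> 1 \<Longrightarrow> g i j \<in> borel_measurable M"
  shows "{\<omega> \<in> space M. \<forall>x. GP_optimizer n p (\<lambda>i j. g i j \<omega>) x \<longrightarrow> linf_norm n x \<le> c} \<in> sets M"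
proof -
  \<comment> \<open>Measurability is known only for entries with positive indices. The others do not
    enter the quadratic form and are replaced by 0.\<close>
  define H where "H \<omega> i j = (if i \<ge> 1 \<and> j \<ge> 1 then g i j \<omega> else 0)" for \<omega> i j
  have H [measurable]: "H \<in> borel_measurable M"
  proof (intro measurable_coordinatewise_then_product)
    fix i j
    show "(\<lambda>\<omega>. H \<omega> i j) \<in> borel_measurable M"
      using g[of i j] by (cases "i \<ge> 1 \<and> j \<ge> 1") (auto simp: H_def)
  qed
  have "GP_obj n p (\<lambda>i j. g i j \<omega>) = GP_obj n p (H \<omega>)" for \<omega>
    by (auto simp: fun_eq_iff GP_obj_def quad_form_def H_def)
  then have opt: "GP_optimizer n p (\<lambda>i j. g i j \<omega>) x \<longleftrightarrow> GP_optimizer n p (H \<omega>) x" for \<omega> x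
    by (simp add: GP_optimizer_def)
  \<comment> \<open>Strict excess over \<open>c\<close> is exhausted by countably many non-strict
    conditions, so that each of them yields a closed set of arrays.\<close>
  have linf: "linf_norm n x \<le> c \<longleftrightarrow> \<not> (\<exists>k\<in>{1..n}. \<exists>m::nat. c + 1 / Suc m \<le> \<bar>x k\<bar>)" for x
  proof -
    have "\<bar>x k\<bar> \<le> c \<longleftrightarrow> \<not> (\<exists>m::nat. c + 1 / Suc m \<le> \<bar>x k\<bar>)" for k
    proof
      assume *: "\<not> (\<exists>m::nat. c + 1 / Suc m \<le> \<bar>x k\<bar>)"
      show "\<bar>x k\<bar> \<le> c"
      proof (rule ccontr)
        assume "\<not> \<bar>x k\<bar> \<le> c"
        then obtain m where "1 / real (Suc m) < \<bar>x k\<bar> - c"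
          using nat_approx_posE[of "\<bar>x k\<bar> - c"] by auto
        then have "c + 1 / Suc m \<le> \<bar>x k\<bar>" by linarith
        with * show False by blast
      qed
    next
      assume *: "\<bar>x k\<bar> \<le> c"
      show "\<not> (\<exists>m::nat. c + 1 / Suc m \<le> \<bar>x k\<bar>)"
      proof
        assume "\<exists>m::nat. c + 1 / Suc m \<le> \<bar>x k\<bar>"
        then obtain m :: nat where "c + 1 / Suc m \<le> \<bar>x k\<bar>" ..
        moreover have "0 < 1 / real (Suc m)" by simp
        ultimately show False using * by linarith
      qed
    qed
    then show ?thesis unfolding linf_norm_def using n by (subst Max_le_iff) auto
  qed
  define D where "D k m = {G. \<exists>x. GP_optimizer n p G x \<and> c + 1 / Suc m \<le> \<bar>x k\<bar>}" for k m :: nat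
  have D: "closed (D k m)" for k m unfolding D_def by (rule closed_GP_optimizer_part[OF p])
  have "{\<omega> \<in> space M. \<forall>x. GP_optimizer n p (\<lambda>i j. g i j \<omega>) x \<longrightarrow> linf_norm n x \<le> c} =
      space M - (\<Union>k\<in>{1..n}. \<Union>m. H -` D k m \<inter> space M)"
    unfolding opt linf D_def by blast
  also have "\<dots> \<in> sets M"
  proof -
    have "(\<Union>m. H -` D k m \<inter> space M) \<in> sets M" for k
      using D by (intro sets.countable_UN'' countableI_type measurable_sets[OF H] borel_closed)
    then have "(\<Union>k\<in>{1..n}. \<Union>m. H -` D k m \<inter> space M) \<in> sets M"
      by (rule sets.finite_UN[OF finite_atLeastAtMost])
    then show ?thesis by (rule sets.Diff[OF sets.top])
  qed
  finally show ?thesis .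
qed

section \<open>Chernoff bound and Gaussian exponential integrals\<close>

text \<open>Markov's inequality for the exponential, which factorizes by independence. The Chernoff
  parameter is fixed at 1 because any scaling can be absorbed into \<open>Y\<close>; nonnegative
  integrals avoid integrability obligations.\<close>

lemma (in prob_space) chernoff_indep_sum:
  fixes Y :: "'i \<Rightarrow> 'a \<Rightarrow> real"
  assumes I: "finite I" and indep: "indep_vars (\<lambda>_. borel) Y I"
    and b: "\<And>i. i \<in> I \<Longrightarrow> (\<integral>\<^sup>+\<omega>. ennreal (exp (Y i \<omega>)) \<partial>M) \<le> ennreal (b i)"
    and b0: "\<And>i. i \<in> I \<Longrightarrow> 0 \<le> b i"
  shows "prob {\<omega> \<in> space M. a \<le> (\<Sum>i\<in>I. Y i \<omega>)} \<le> exp (- a) * (\<Prod>i\<in>I. b i)"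
proof -
  have Y: "\<And>i. i \<in> I \<Longrightarrow> Y i \<in> borel_measurable M"
    using indep by (simp add: indep_vars_def)
  have "emeasure M {\<omega> \<in> space M. a \<le> (\<Sum>i\<in>I. Y i \<omega>)} \<le>
      ennreal (exp (- 1 * a)) * (\<integral>\<^sup>+\<omega>. ennreal (exp (1 * (\<Sum>i\<in>I. Y i \<omega>))) * indicator (space M) \<omega> \<partial>M)"
    by (rule Chernoff_ineq_nn_integral_ge) (auto intro!: borel_measurable_sum borel_measurable_times Y)
  also have "(\<integral>\<^sup>+\<omega>. ennreal (exp (1 * (\<Sum>i\<in>I. Y i \<omega>))) * indicator (space M) \<omega> \<partial>M) =
      (\<integral>\<^sup>+\<omega>. (\<Prod>i\<in>I. ennreal (exp (Y i \<omega>))) \<partial>M)"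
    by (intro nn_integral_cong) (simp add: exp_sum I prod_ennreal)
  also have "\<dots> = (\<Prod>i\<in>I. \<integral>\<^sup>+\<omega>. ennreal (exp (Y i \<omega>)) \<partial>M)"
    by (intro indep_vars_nn_integral I indep_vars_compose2[OF indep]) auto
  also have "\<dots> \<le> (\<Prod>i\<in>I. ennreal (b i))" by (intro prod_mono_ennreal b)
  also have "\<dots> = ennreal (\<Prod>i\<in>I. b i)" using b0 by (intro prod_ennreal)
  finally have "emeasure M {\<omega> \<in> space M. a \<le> (\<Sum>i\<in>I. Y i \<omega>)} \<le> ennreal (exp (- a) * (\<Prod>i\<in>I. b i))"
    by (simp add: ennreal_mult' mult_left_mono)
  then show ?thesis
    using b0 by (simp add: emeasure_eq_measure prod_nonneg)
qed

lemma nn_integral_normal_density: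
  assumes "\<sigma> > 0"
  shows "(\<integral>\<^sup>+x. ennreal (normal_density \<mu> \<sigma> x) \<partial>lborel) = 1"
  using assms by (subst nn_integral_eq_integral) auto

text \<open>If tilting by \<open>exp (h x)\<close> turns the density into a multiple of another
  normal density, the factor is the value of the integral.\<close>

lemma nn_integral_gaussian_tilt:
  assumes X: "distributed M lborel X f" and \<sigma>: "\<sigma> > 0" and c: "c \<ge> 0"
    and h: "h \<in> borel_measurable borel" and f: "\<And>x. f x \<ge> 0"
    and eq: "\<And>x. f x * exp (h x) = c * normal_density \<mu> \<sigma> x"
  shows "(\<integral>\<^sup>+\<omega>. ennreal (exp (h (X \<omega>))) \<partial>M) = ennreal c"
proof -
  have "(\<integral>\<^sup>+\<omega>. ennreal (exp (h (X \<omega>))) \<partial>M) = (\<integral>\<^sup>+x. ennreal (f x) * ennreal (exp (h x)) \<partial>lborel)"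
    by (rule distributed_nn_integral[OF X, symmetric]) (use h in simp)
  also have "\<dots> = (\<integral>\<^sup>+x. ennreal c * ennreal (normal_density \<mu> \<sigma> x) \<partial>lborel)"
    using f c by (intro nn_integral_cong) (simp add: eq flip: ennreal_mult')
  also have "\<dots> = ennreal c"
    using nn_integral_normal_density[OF \<sigma>] by (simp add: nn_integral_cmult)
  finally show ?thesis .
qed

lemma nn_integral_exp_gaussian:
  assumes "distributed M lborel X std_normal_density"
  shows "(\<integral>\<^sup>+\<omega>. ennreal (exp (a * X \<omega>)) \<partial>M) = ennreal (exp (a\<^sup>2 / 2))"
proof (rule nn_integral_gaussian_tilt[OF assms, of 1])
  fix x
  have "- x\<^sup>2 / 2 + a * x = a\<^sup>2 / 2 + - (x - a)\<^sup>2 / 2"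
    by (simp add: power2_eq_square field_simps)
  then have "exp (- x\<^sup>2 / 2) * exp (a * x) = exp (a\<^sup>2 / 2) * exp (- (x - a)\<^sup>2 / 2)"
    by (simp flip: exp_add)
  then show "std_normal_density x * exp (a * x) = exp (a\<^sup>2 / 2) * normal_density a 1 x"
    unfolding std_normal_density_def normal_density_def by simp
qed auto

lemma nn_integral_exp_gaussian_square:
  assumes "distributed M lborel X std_normal_density"
  shows "(\<integral>\<^sup>+\<omega>. ennreal (exp ((X \<omega>)\<^sup>2 / 4)) \<partial>M) = ennreal (sqrt 2)"
proof (rule nn_integral_gaussian_tilt[OF assms, of "sqrt 2"])
  fix x :: real
  \<comment> \<open>The tilted density is proportional to the normal density of variance 2.\<close>
  have "exp (- x\<^sup>2 / 2) * exp (x\<^sup>2 / 4) = exp (- x\<^sup>2 / 4)"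
    by (simp flip: exp_add)
  then show "std_normal_density x * exp (x\<^sup>2 / 4) = sqrt 2 * normal_density 0 (sqrt 2) x"
    unfolding std_normal_density_def normal_density_def
    by (simp add: real_sqrt_mult field_simps)
qed auto

text \<open>Bounded density near the origin is all that anti-concentration needs: the two summands come
  from \<open>\<bar>X\<bar> \<le> \<theta> \<sigma>\<close> and \<open>\<bar>X\<bar> > \<theta> \<sigma>\<close>.\<close>

lemma nn_integral_exp_neg_abs_gaussian:
  assumes X: "distributed M lborel X (normal_density 0 \<sigma>)" and \<sigma>: "\<sigma> > 0" and \<theta>: "\<theta> \<ge> 0" and \<eta>: "\<eta> \<ge> 0"
  shows "(\<integral>\<^sup>+\<omega>. ennreal (exp (- (\<eta> / \<sigma> * \<bar>X \<omega>\<bar>))) \<partial>M) \<le> ennreal (\<theta> + exp (- (\<eta> * \<theta>)))"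
proof -
  \<comment> \<open>This uses \<open>2 * pi \<ge> 4\<close>. Integrated over the interval of length
    \<open>2 * \<theta> * \<sigma>\<close>, the bound contributes exactly
    \<open>\<theta>\<close>.\<close>
  have le: "normal_density 0 \<sigma> x \<le> 1 / (2 * \<sigma>)" for x
  proof -
    have "2 * \<sigma> = sqrt (4 * \<sigma>\<^sup>2)" using \<sigma> by (simp add: real_sqrt_mult)
    also have "\<dots> \<le> sqrt (2 * pi * \<sigma>\<^sup>2)"
      using pi_ge_two by (intro real_sqrt_le_mono mult_right_mono) auto
    finally have "1 / sqrt (2 * pi * \<sigma>\<^sup>2) \<le> 1 / (2 * \<sigma>)" using \<sigma> by (intro divide_left_mono) auto
    moreover have "exp (- (x - 0)\<^sup>2 / (2 * \<sigma>\<^sup>2)) \<le> 1" by simp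
    ultimately have "1 / sqrt (2 * pi * \<sigma>\<^sup>2) * exp (- (x - 0)\<^sup>2 / (2 * \<sigma>\<^sup>2)) \<le> 1 / (2 * \<sigma>) * 1"
      using \<sigma> by (intro mult_mono) auto
    then show ?thesis by (simp add: normal_density_def)
  qed
  have "(\<integral>\<^sup>+\<omega>. ennreal (exp (- (\<eta> / \<sigma> * \<bar>X \<omega>\<bar>))) \<partial>M) =
      (\<integral>\<^sup>+x. ennreal (normal_density 0 \<sigma> x) * ennreal (exp (- (\<eta> / \<sigma> * \<bar>x\<bar>))) \<partial>lborel)"
    by (rule distributed_nn_integral[OF X, symmetric]) simp
  also have "\<dots> \<le> (\<integral>\<^sup>+x. ennreal (1 / (2 * \<sigma>)) * indicator {- (\<theta> * \<sigma>)..\<theta> * \<sigma>} x +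
      ennreal (normal_density 0 \<sigma> x) * ennreal (exp (- (\<eta> * \<theta>))) \<partial>lborel)"
  proof (intro nn_integral_mono)
    fix x :: real
    show "ennreal (normal_density 0 \<sigma> x) * ennreal (exp (- (\<eta> / \<sigma> * \<bar>x\<bar>))) \<le>
      ennreal (1 / (2 * \<sigma>)) * indicator {- (\<theta> * \<sigma>)..\<theta> * \<sigma>} x +
      ennreal (normal_density 0 \<sigma> x) * ennreal (exp (- (\<eta> * \<theta>)))"
    proof (cases "\<bar>x\<bar> \<le> \<theta> * \<sigma>")
      case True
      have "0 \<le> \<eta> / \<sigma> * \<bar>x\<bar>" using \<eta> \<sigma> by simp
      then have "normal_density 0 \<sigma> x * exp (- (\<eta> / \<sigma> * \<bar>x\<bar>)) \<le> 1 / (2 * \<sigma>) * 1"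
        using le[of x] \<sigma> by (intro mult_mono) auto
      then have "ennreal (normal_density 0 \<sigma> x * exp (- (\<eta> / \<sigma> * \<bar>x\<bar>))) \<le> ennreal (1 / (2 * \<sigma>))"
        by (intro ennreal_leI) simp
      moreover have "x \<in> {- (\<theta> * \<sigma>)..\<theta> * \<sigma>}" using True by auto
      ultimately have "ennreal (normal_density 0 \<sigma> x) * ennreal (exp (- (\<eta> / \<sigma> * \<bar>x\<bar>))) \<le>
        ennreal (1 / (2 * \<sigma>)) * indicator {- (\<theta> * \<sigma>)..\<theta> * \<sigma>} x"
        by (simp flip: ennreal_mult')
      then show ?thesis by (rule add_increasing2[OF zero_le])
    next
      case False
      then have "\<eta> * \<theta> \<le> \<eta> / \<sigma> * \<bar>x\<bar>"
        using \<eta> \<sigma> mult_left_mono[of "\<theta> * \<sigma>" "\<bar>x\<bar>" "\<eta> / \<sigma>"] by simp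
      then have "ennreal (exp (- (\<eta> / \<sigma> * \<bar>x\<bar>))) \<le> ennreal (exp (- (\<eta> * \<theta>)))"
        by (intro ennreal_leI) simp
      then show ?thesis by (intro add_increasing mult_left_mono) auto
    qed
  qed
  also have "\<dots> = ennreal (1 / (2 * \<sigma>)) * ennreal (2 * (\<theta> * \<sigma>)) + ennreal (exp (- (\<eta> * \<theta>)))"
    using \<sigma> \<theta> nn_integral_normal_density[OF \<sigma>, of 0]
    by (simp add: nn_integral_add nn_integral_cmult nn_integral_multc nn_integral_cmult_indicator mult_ac)
  also have "\<dots> = ennreal (\<theta> + exp (- (\<eta> * \<theta>)))"
    using \<sigma> \<theta> by (simp flip: ennreal_mult' ennreal_plus)
  finally show ?thesis .
qed

section \<open>A test vector with a large quadratic form\<close>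

definition prefix_vec :: "nat \<Rightarrow> nat \<Rightarrow> real" where
  "prefix_vec h i = (if i \<le> h then 1 else 0)"

text \<open>The sign pattern is encoded by a set because the pattern eventually chosen depends on
  the array; a union bound can then run over the finite \<open>Pow {1..n}\<close>.\<close>

definition suffix_signs :: "nat \<Rightarrow> nat set \<Rightarrow> nat \<Rightarrow> real" where
  "suffix_signs h T i = (if h < i then if i \<in> T then 1 else -1 else 0)"

lemma abs_prefix_vec_le: "\<bar>prefix_vec h i\<bar> \<le> 1"
  by (simp add: prefix_vec_def)

lemma abs_suffix_signs_le: "\<bar>suffix_signs h T i\<bar> \<le> 1"
  by (simp add: suffix_signs_def)

text \<open>Expansion of the form on a sum; as \<open>G\<close> is not symmetric, the cross term
  involves \<open>G i j + G j i\<close>.\<close>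

lemma quad_form_add_scale:
  "quad_form n G (\<lambda>i. u i + \<epsilon> * v i) = quad_form n G u +
    \<epsilon> * (\<Sum>i\<in>{1..n}. v i * (\<Sum>j\<in>{1..n}. u j * (G i j + G j i))) + \<epsilon>\<^sup>2 * quad_form n G v"
proof -
  have swap: "(\<Sum>i\<in>{1..n}. \<Sum>j\<in>{1..n}. G i j * v j * u i) = (\<Sum>i\<in>{1..n}. \<Sum>j\<in>{1..n}. G j i * v i * u j)"
    by (rule sum.swap)
  have "(\<Sum>i\<in>{1..n}. v i * (\<Sum>j\<in>{1..n}. u j * (G i j + G j i))) =
      (\<Sum>i\<in>{1..n}. \<Sum>j\<in>{1..n}. G i j * u j * v i) + (\<Sum>i\<in>{1..n}. \<Sum>j\<in>{1..n}. G j i * v i * u j)"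
    unfolding sum_distrib_left sum.distrib[symmetric] by (intro sum.cong refl) (simp add: algebra_simps)
  moreover have "quad_form n G (\<lambda>i. u i + \<epsilon> * v i) = quad_form n G u +
      \<epsilon> * ((\<Sum>i\<in>{1..n}. \<Sum>j\<in>{1..n}. G i j * u j * v i) + (\<Sum>i\<in>{1..n}. \<Sum>j\<in>{1..n}. G i j * v j * u i)) +
      \<epsilon>\<^sup>2 * quad_form n G v"
    unfolding quad_form_def sum_distrib_left sum_distrib_right sum.distrib[symmetric]
    by (intro sum.cong refl) (simp add: algebra_simps power2_eq_square)
  ultimately show ?thesis unfolding swap by simp
qed

text \<open>The vector is 1 on the first half of the indices and \<open>\<epsilon>\<close> times the sign of the row sum
  \<open>\<Sum>j\<le>h. G i j + G j i\<close> on the second half. For small \<open>\<epsilon>\<close> the cross term, of order \<open>\<epsilon>\<close>, beats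
  the \<open>\<epsilon>\<^sup>2\<close> contribution of the second block.\<close>

lemma exists_large_quad_form:
  assumes h: "n \<le> 8 * h" "2 * h \<le> n"
    and first: "- (1 / 2 ^ 20 * real n powr (3 / 2)) \<le> quad_form n G (prefix_vec h)"
    and second: "\<And>T. T \<subseteq> {1..n} \<Longrightarrow> - (2 * real n powr (3 / 2)) \<le> quad_form n G (suffix_signs h T)"
    and cross: "sqrt (2 * real h) * real (n - h) / 64 \<le>
      (\<Sum>i\<in>{h + 1..n}. \<bar>\<Sum>j\<in>{1..h}. G i j + G j i\<bar>)"
  shows "\<exists>y. (\<forall>i. \<bar>y i\<bar> \<le> 1) \<and> 1 / 2 ^ 20 * real n powr (3 / 2) \<le> quad_form n G y"
proof -
  define N where "N = real n powr (3 / 2)"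
  define S where "S i = (\<Sum>j\<in>{1..h}. G i j + G j i)" for i
  define T where "T = {i \<in> {1..n}. S i \<ge> 0}"
  define y where "y i = prefix_vec h i + 1 / 1024 * suffix_signs h T i" for i
  have N: "N = sqrt (real n) * real n"
  proof (cases "n = 0")
    case False
    have "real n powr (1 / 2 + 1) = real n powr (1 / 2) * real n powr 1" by (rule powr_add)
    then show ?thesis using False by (simp add: N_def powr_half_sqrt)
  qed (simp add: N_def)
  \<comment> \<open>From \<open>n \<le> 8 * h\<close> and \<open>2 * h \<le> n\<close>, the two
    factors in \<open>cross\<close> are at least \<open>sqrt n / 2\<close> and \<open>n / 2\<close>,
    so the cross sum is at least \<open>N / 256\<close>.\<close>
  have "sqrt (real n) / 2 = sqrt (real n / 4)" by (simp add: real_sqrt_divide)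
  also have "\<dots> \<le> sqrt (2 * real h)" using h by (intro real_sqrt_le_mono) simp
  finally have "sqrt (real n) / 2 * (real n / 2) \<le> sqrt (2 * real h) * real (n - h)"
    using h by (intro mult_mono) auto
  then have S: "N / 256 \<le> (\<Sum>i\<in>{h + 1..n}. \<bar>S i\<bar>)"
    using cross by (simp add: N S_def)
  have "(\<Sum>j\<in>{1..n}. prefix_vec h j * (G i j + G j i)) = S i" for i
  proof -
    have "S i = (\<Sum>j\<in>{1..h}. prefix_vec h j * (G i j + G j i))"
      unfolding S_def by (intro sum.cong) (auto simp: prefix_vec_def)
    also have "\<dots> = (\<Sum>j\<in>{1..n}. prefix_vec h j * (G i j + G j i))"
      using h by (intro sum.mono_neutral_left) (auto simp: prefix_vec_def)
    finally show ?thesis ..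
  qed
  moreover have "(\<Sum>i\<in>{1..n}. suffix_signs h T i * S i) = (\<Sum>i\<in>{h + 1..n}. \<bar>S i\<bar>)"
  proof -
    have "(\<Sum>i\<in>{h + 1..n}. \<bar>S i\<bar>) = (\<Sum>i\<in>{h + 1..n}. suffix_signs h T i * S i)"
      by (intro sum.cong) (auto simp: suffix_signs_def T_def)
    also have "\<dots> = (\<Sum>i\<in>{1..n}. suffix_signs h T i * S i)"
      by (intro sum.mono_neutral_left) (auto simp: suffix_signs_def)
    finally show ?thesis ..
  qed
  ultimately have "quad_form n G y = quad_form n G (prefix_vec h) +
      1 / 1024 * (\<Sum>i\<in>{h + 1..n}. \<bar>S i\<bar>) + (1 / 1024)\<^sup>2 * quad_form n G (suffix_signs h T)"
    unfolding y_def quad_form_add_scale by simp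
  moreover have "- (2 * N) \<le> quad_form n G (suffix_signs h T)"
    unfolding N_def by (rule second) (auto simp: T_def)
  \<comment> \<open>In units of \<open>N / 2 ^ 20\<close> the cross term gives at least 4, while the
    first and second blocks cost at most 1 and 2, leaving 1.\<close>
  ultimately have "1 / 2 ^ 20 * N \<le> quad_form n G y"
    using first S unfolding N_def[symmetric] by (simp add: power2_eq_square)
  moreover have "\<bar>y i\<bar> \<le> 1" for i
    by (simp add: y_def prefix_vec_def suffix_signs_def)
  ultimately show ?thesis unfolding N_def by blast
qed

section \<open>Probability estimates for the Gaussian array\<close>

locale gaussian_array = prob_space M for M :: "'a measure" +
  fixes g :: "nat \<Rightarrow> nat \<Rightarrow> 'a \<Rightarrow> real"
  assumes indep: "indep_vars (\<lambda>_. borel) (\<lambda>(i, j). g i j) ({1..} \<times> {1..})"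
    and gaussian: "\<And>i j. i \<ge> 1 \<Longrightarrow> j \<ge> 1 \<Longrightarrow> distributed M lborel (g i j) std_normal_density"
begin

lemma measurable_entry: "i \<ge> 1 \<Longrightarrow> j \<ge> 1 \<Longrightarrow> g i j \<in> borel_measurable M"
  using distributed_measurable[OF gaussian[of i j]] by simp

lemma indep_transformed:
  assumes "J \<subseteq> {1..} \<times> {1..}" "\<And>q. q \<in> J \<Longrightarrow> f q \<in> borel_measurable borel"
  shows "indep_vars (\<lambda>_. borel) (\<lambda>q \<omega>. f q (g (fst q) (snd q) \<omega>) :: real) J"
  using indep_vars_compose2[OF indep_vars_subset[OF indep assms(1)], of f "\<lambda>_. borel"] assms(2)
  by (simp add: case_prod_beta)

text \<open>Each factor \<open>exp (X^2 / 4)\<close> has mean \<open>sqrt 2\<close>, which is below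
  \<open>exp 1\<close>; the threshold \<open>3 * n\<close> for the scaled sum therefore leaves the
  exponent \<open>- 3 * n + n\<close>.\<close>

lemma prob_sum_squares:
  assumes J: "finite J" "J \<subseteq> {1..} \<times> {1..}" and c: "card J = n"
  shows "prob {\<omega> \<in> space M. 12 * real n \<le> (\<Sum>q\<in>J. (g (fst q) (snd q) \<omega>)\<^sup>2)} \<le> exp (- 2 * real n)"
proof -
  have "prob {\<omega> \<in> space M. 3 * real n \<le> (\<Sum>q\<in>J. (g (fst q) (snd q) \<omega>)\<^sup>2 / 4)} \<le>
      exp (- (3 * real n)) * (\<Prod>q\<in>J. sqrt 2)"
  proof (rule chernoff_indep_sum)
    show "indep_vars (\<lambda>_. borel) (\<lambda>q \<omega>. (g (fst q) (snd q) \<omega>)\<^sup>2 / 4) J"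
      by (rule indep_transformed[OF J(2), of "\<lambda>_ x. x\<^sup>2 / 4"]) simp
  qed (use J in \<open>auto simp: nn_integral_exp_gaussian_square[OF gaussian]\<close>)
  also have "(\<Prod>q\<in>J. sqrt 2) \<le> exp (real n)"
  proof -
    have "sqrt 2 \<le> 2" by (simp add: real_le_lsqrt)
    also have "(2::real) \<le> exp 1" using exp_ge_add_one_self[of 1] by simp
    finally have "sqrt 2 ^ n \<le> exp 1 ^ n" by (intro power_mono) auto
    then show ?thesis by (simp add: c flip: exp_of_nat_mult)
  qed
  also have "exp (- (3 * real n)) * exp (real n) = exp (- 2 * real n)"
    by (simp flip: exp_add)
  also have "{\<omega> \<in> space M. 3 * real n \<le> (\<Sum>q\<in>J. (g (fst q) (snd q) \<omega>)\<^sup>2 / 4)} =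
      {\<omega> \<in> space M. 12 * real n \<le> (\<Sum>q\<in>J. (g (fst q) (snd q) \<omega>)\<^sup>2)}"
    by (auto simp flip: sum_divide_distrib)
  finally show ?thesis by simp
qed

lemma quad_form_eq_sum_prod:
  "quad_form n G x = (\<Sum>q\<in>{1..n} \<times> {1..n}. x (snd q) * x (fst q) * G (fst q) (snd q))"
  unfolding quad_form_def sum_distrib_right sum.cartesian_product by (intro sum.cong) auto

text \<open>The \<open>n^2\<close> independent terms contribute at most \<open>n^2 * l^2 / 2\<close>
  to the exponent, against a gain of \<open>l * s * n powr (3 / 2)\<close>. The choice
  \<open>l = s * n powr (- 1 / 2)\<close> is the optimal one.\<close>

lemma prob_quad_form_le:
  assumes n: "n \<ge> 1" and s: "s > 0" and \<tau>: "\<And>i. i \<in> {1..n} \<Longrightarrow> \<bar>\<tau> i\<bar> \<le> 1"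
  shows "prob {\<omega> \<in> space M. quad_form n (\<lambda>i j. g i j \<omega>) \<tau> \<le> - (s * real n powr (3 / 2))} \<le>
    exp (- (s\<^sup>2 * real n / 2))"
proof -
  define l where "l = s * real n powr (- 1 / 2)"
  have l: "l > 0" using s n by (simp add: l_def)
  have l1: "l * (s * real n powr (3 / 2)) = s\<^sup>2 * real n"
    using n unfolding l_def by (simp add: power2_eq_square mult_ac flip: powr_add)
  have l2: "l\<^sup>2 * real n = s\<^sup>2"
  proof -
    have "(real n powr (- 1 / 2))\<^sup>2 = inverse (real n)"
      using n by (simp add: power2_eq_square powr_minus[symmetric] flip: powr_add)
        (simp add: powr_minus inverse_eq_divide)
    then show ?thesis using n by (simp add: l_def power_mult_distrib)
  qed
  define f where "f q x = (- l * \<tau> (snd q) * \<tau> (fst q)) * x" for q and x :: real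
  have "prob {\<omega> \<in> space M. s\<^sup>2 * real n \<le> (\<Sum>q\<in>{1..n} \<times> {1..n}. f q (g (fst q) (snd q) \<omega>))} \<le>
      exp (- (s\<^sup>2 * real n)) * (\<Prod>q\<in>{1..n} \<times> {1..n}. exp (l\<^sup>2 / 2))"
  proof (rule chernoff_indep_sum)
    show "indep_vars (\<lambda>_. borel) (\<lambda>q \<omega>. f q (g (fst q) (snd q) \<omega>)) ({1..n} \<times> {1..n})"
      by (rule indep_transformed) (auto simp: f_def)
    fix q assume q: "q \<in> {1..n} \<times> {1..n}"
    have "\<bar>\<tau> (snd q) * \<tau> (fst q)\<bar> \<le> 1 * 1"
      unfolding abs_mult using q by (intro mult_mono \<tau>) auto
    then have "(\<tau> (snd q) * \<tau> (fst q))\<^sup>2 \<le> 1" by (simp add: abs_square_le_1)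
    then have "l\<^sup>2 * (\<tau> (snd q) * \<tau> (fst q))\<^sup>2 \<le> l\<^sup>2 * 1" by (intro mult_left_mono) auto
    then have "(- l * \<tau> (snd q) * \<tau> (fst q))\<^sup>2 / 2 \<le> l\<^sup>2 / 2"
      by (simp add: power_mult_distrib mult.assoc)
    then show "(\<integral>\<^sup>+\<omega>. ennreal (exp (f q (g (fst q) (snd q) \<omega>))) \<partial>M) \<le> ennreal (exp (l\<^sup>2 / 2))"
      unfolding f_def using q by (subst nn_integral_exp_gaussian[OF gaussian]) (auto intro!: ennreal_leI)
  qed auto
  also have "exp (- (s\<^sup>2 * real n)) * (\<Prod>q\<in>{1..n} \<times> {1..n}. exp (l\<^sup>2 / 2)) = exp (- (s\<^sup>2 * real n / 2))"
  proof -
    have "(\<Prod>q\<in>{1..n} \<times> {1..n}. exp (l\<^sup>2 / 2)) = exp (real n * (l\<^sup>2 * real n) / 2)"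
      by (simp add: power2_eq_square flip: exp_of_nat_mult)
    then show ?thesis unfolding l2 by (simp add: mult.commute flip: exp_add)
  qed
  also have "{\<omega> \<in> space M. s\<^sup>2 * real n \<le> (\<Sum>q\<in>{1..n} \<times> {1..n}. f q (g (fst q) (snd q) \<omega>))} =
      {\<omega> \<in> space M. quad_form n (\<lambda>i j. g i j \<omega>) \<tau> \<le> - (s * real n powr (3 / 2))}"
  proof (intro Collect_cong conj_cong refl)
    fix \<omega>
    have "(\<Sum>q\<in>{1..n} \<times> {1..n}. f q (g (fst q) (snd q) \<omega>)) =
        l * (- quad_form n (\<lambda>i j. g i j \<omega>) \<tau>)"
      unfolding quad_form_eq_sum_prod sum_distrib_left sum_negf[symmetric] f_def
      by (intro sum.cong refl) simp
    then show "s\<^sup>2 * real n \<le> (\<Sum>q\<in>{1..n} \<times> {1..n}. f q (g (fst q) (snd q) \<omega>)) \<longleftrightarrow>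
        quad_form n (\<lambda>i j. g i j \<omega>) \<tau> \<le> - (s * real n powr (3 / 2))"
      using l by (simp only: l1[symmetric] mult_le_cancel_left_pos) linarith
  qed
  finally show ?thesis .
qed

text \<open>The inner sums for different \<open>i > h\<close> use disjoint sets of entries, hence
  are independent centred normals of variance \<open>2 * h\<close>. Anti-concentration makes it
  exponentially unlikely that their moduli are small on average.\<close>

lemma prob_cross_sum_le:
  assumes h: "h \<ge> 1"
  shows "prob {\<omega> \<in> space M. (\<Sum>i\<in>{h + 1..n}. \<bar>\<Sum>j\<in>{1..h}. g i j \<omega> + g j i \<omega>\<bar>) \<le>
    sqrt (2 * real h) * real (n - h) / 64} \<le> exp (- real (n - h))"
proof -
  define \<sigma> where "\<sigma> = sqrt (2 * real h)"
  define X where "X = (\<lambda>(i, j). g i j)"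
  define K where "K i = {i} \<times> {1..h} \<union> {1..h} \<times> {i}" for i
  define S where "S i \<omega> = (\<Sum>j\<in>{1..h}. g i j \<omega> + g j i \<omega>)" for i \<omega>
  \<comment> \<open>These are the values \<open>\<theta> = 1 / 16\<close> and
    \<open>\<eta> = 64\<close> of the anti-concentration bound, chosen so that
    \<open>exp 2 * b \<le> 1\<close>: indeed \<open>9 / 16 + 1 / 4 < 1\<close>.\<close>
  define b where "b = 1 / 16 + exp (- (64 * (1 / 16 :: real)))"
  have \<sigma>: "\<sigma> > 0" using h by (simp add: \<sigma>_def)
  have K: "K i \<subseteq> {1..} \<times> {1..}" "finite (K i)" "K i \<noteq> {}" if "i \<in> {h + 1..n}" for i
    using that h by (auto simp: K_def)
  have sumK: "(\<Sum>q\<in>K i. f q) = (\<Sum>j\<in>{1..h}. f (i, j) + f (j, i))" if "i \<in> {h + 1..n}"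
    for i and f :: "nat \<times> nat \<Rightarrow> real"
  proof -
    have "(\<Sum>q\<in>K i. f q) = (\<Sum>q\<in>{i} \<times> {1..h}. f q) + (\<Sum>q\<in>{1..h} \<times> {i}. f q)"
      unfolding K_def using that by (intro sum.union_disjoint) auto
    then show ?thesis by (simp add: sum.distrib sum.cartesian_product')
  qed
  have SK: "S i \<omega> = (\<Sum>q\<in>K i. X q \<omega>)" if "i \<in> {h + 1..n}" for i \<omega>
    using sumK[OF that, of "\<lambda>q. X q \<omega>"] by (simp add: S_def X_def)
  have indepX: "indep_vars (\<lambda>_. borel) X ({1..} \<times> {1..})" using indep by (simp add: X_def)
  have dist: "distributed M lborel (S i) (normal_density 0 \<sigma>)" if i: "i \<in> {h + 1..n}" for i
  proof -
    have "distributed M lborel (\<lambda>\<omega>. \<Sum>q\<in>K i. X q \<omega>)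
        (normal_density (\<Sum>q\<in>K i. 0) (sqrt (\<Sum>q\<in>K i. 1\<^sup>2)))"
      using K[OF i] by (intro sum_indep_normal indep_vars_subset[OF indepX])
        (auto simp: X_def intro!: gaussian)
    moreover have "(\<Sum>q\<in>K i. 1\<^sup>2) = 2 * real h"
      unfolding sumK[OF i] by simp
    moreover have "(\<lambda>\<omega>. \<Sum>q\<in>K i. X q \<omega>) = S i" using SK[OF i] by auto
    ultimately show ?thesis by (simp add: \<sigma>_def)
  qed
  \<comment> \<open>Every pair in \<open>K i\<close> has exactly one index above \<open>h\<close>,
    namely \<open>i\<close>, so the blocks cannot overlap.\<close>
  have "disjoint_family_on K {h + 1..n}"
    by (auto simp: disjoint_family_on_def K_def)
  then have "indep_vars (\<lambda>i. PiM (K i) (\<lambda>_. borel)) (\<lambda>i \<omega>. restrict (\<lambda>q. X q \<omega>) (K i)) {h + 1..n}"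
    using K by (intro indep_vars_restrict[OF indepX])
  then have "indep_vars (\<lambda>_. borel)
      (\<lambda>i \<omega>. (\<lambda>f. - (64 / \<sigma> * \<bar>\<Sum>q\<in>K i. f q\<bar>)) (restrict (\<lambda>q. X q \<omega>) (K i))) {h + 1..n}"
    by (rule indep_vars_compose2) measurable
  also have "?this \<longleftrightarrow> indep_vars (\<lambda>_. borel) (\<lambda>i \<omega>. - (64 / \<sigma> * \<bar>S i \<omega>\<bar>)) {h + 1..n}"
    by (intro indep_vars_cong) (auto simp: SK fun_eq_iff intro!: sum.cong)
  finally have "prob {\<omega> \<in> space M. - real (n - h) \<le> (\<Sum>i\<in>{h + 1..n}. - (64 / \<sigma> * \<bar>S i \<omega>\<bar>))} \<le>
      exp (- (- real (n - h))) * (\<Prod>i\<in>{h + 1..n}. b)"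
    unfolding b_def
    by (intro chernoff_indep_sum nn_integral_exp_neg_abs_gaussian[OF dist \<sigma>]) auto
  also have "\<dots> = (exp 1 * b) ^ (n - h)"
    by (simp add: power_mult_distrib flip: exp_of_nat_mult)
  also have "\<dots> \<le> exp (- 1) ^ (n - h)"
  proof (intro power_mono)
    define z where "z = exp (- 2 :: real)"
    have e: "exp 1 * exp 1 * z = 1" by (simp add: z_def flip: exp_add)
    have "exp 1 * exp 1 \<le> 3 * (3::real)" using exp_le by (intro mult_mono) auto
    moreover have "z * 4 \<le> 1"
    proof -
      have "2 \<le> exp (1::real)" using exp_ge_add_one_self[of 1] by simp
      then have "2 * 2 \<le> exp 1 * exp (1::real)" by (intro mult_mono) auto
      then have "z * (2 * 2) \<le> z * (exp 1 * exp 1)" by (intro mult_left_mono) (auto simp: z_def)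
      then show ?thesis using e by (simp add: mult.commute)
    qed
    moreover have "exp 1 * (exp 1 * b) = exp 1 * exp 1 / 16 + exp 1 * exp 1 * z * z"
      by (simp add: b_def z_def distrib_left flip: exp_add)
    ultimately have "exp 1 * (exp 1 * b) \<le> 1" unfolding e by simp
    then show "exp 1 * b \<le> exp (- 1)" by (simp add: exp_minus field_simps)
  qed (simp add: b_def)
  also have "\<dots> = exp (- real (n - h))" by (simp flip: exp_of_nat_mult)
  also have "{\<omega> \<in> space M. - real (n - h) \<le> (\<Sum>i\<in>{h + 1..n}. - (64 / \<sigma> * \<bar>S i \<omega>\<bar>))} =
      {\<omega> \<in> space M. (\<Sum>i\<in>{h + 1..n}. \<bar>S i \<omega>\<bar>) \<le> \<sigma> * real (n - h) / 64}"
    unfolding sum_negf sum_distrib_left[symmetric] using \<sigma> by (simp add: field_simps)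
  finally show ?thesis by (simp add: S_def \<sigma>_def)
qed

lemma measurable_quad_form: "(\<lambda>\<omega>. quad_form n (\<lambda>i j. g i j \<omega>) \<tau>) \<in> borel_measurable M"
  unfolding quad_form_def
  by (intro borel_measurable_sum borel_measurable_times borel_measurable_const measurable_entry) auto

text \<open>Union bound over the rows and columns; half of the exponential rate absorbs the factor
  \<open>n\<close>.\<close>

lemma prob_row_or_column_large:
  "prob (\<Union>k\<in>{1..n}. {\<omega> \<in> space M. 12 * real n \<le> (\<Sum>j\<in>{1..n}. (g k j \<omega>)\<^sup>2)} \<union>
      {\<omega> \<in> space M. 12 * real n \<le> (\<Sum>j\<in>{1..n}. (g j k \<omega>)\<^sup>2)}) \<le> 2 * exp (- real n)"
    (is "prob (\<Union>k\<in>_. ?R k \<union> ?C k) \<le> _")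
proof -
  have sets: "?R k \<in> sets M" "?C k \<in> sets M" if "k \<in> {1..n}" for k
    using that by (auto intro!: borel_measurable_le borel_measurable_sum borel_measurable_power
        measurable_entry)
  have one: "prob (?R k) \<le> exp (- 2 * real n)" "prob (?C k) \<le> exp (- 2 * real n)"
    if k: "k \<in> {1..n}" for k
  proof -
    have "{k} \<times> {1..n} \<subseteq> {1..} \<times> {1..}" "{1..n} \<times> {k} \<subseteq> {1..} \<times> {1..}"
      using k by auto
    then show "prob (?R k) \<le> exp (- 2 * real n)" "prob (?C k) \<le> exp (- 2 * real n)"
      using prob_sum_squares[of "{k} \<times> {1..n}" n] prob_sum_squares[of "{1..n} \<times> {k}" n]
      by (simp_all add: sum.cartesian_product')
  qed
  have "prob (\<Union>k\<in>{1..n}. ?R k \<union> ?C k) \<le> (\<Sum>k\<in>{1..n}. prob (?R k \<union> ?C k))"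
    using sets by (intro finite_measure_subadditive_finite) auto
  also have "\<dots> \<le> (\<Sum>k\<in>{1..n}. 2 * exp (- 2 * real n))"
  proof (intro sum_mono)
    fix k assume k: "k \<in> {1..n}"
    show "prob (?R k \<union> ?C k) \<le> 2 * exp (- 2 * real n)"
      using measure_Un_le[OF sets[OF k]] one[OF k] by linarith
  qed
  also have "\<dots> = 2 * (real n * exp (- 2 * real n))" by simp
  also have "\<dots> \<le> 2 * (exp (real n) * exp (- 2 * real n))"
  proof (intro mult_left_mono mult_right_mono)
    show "real n \<le> exp (real n)" using exp_ge_add_one_self[of "real n"] by linarith
  qed auto
  also have "\<dots> = 2 * exp (- real n)" by (simp flip: exp_add)
  finally show ?thesis .
qed

text \<open>The level 2 gives each pattern probability at most \<open>exp (- 2 * n)\<close>, which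
  beats the \<open>2 ^ n\<close> sets in the union bound.\<close>

lemma prob_suffix_quad_form_small:
  assumes n: "n \<ge> 1"
  shows "prob (\<Union>T\<in>Pow {1..n}. {\<omega> \<in> space M.
      quad_form n (\<lambda>i j. g i j \<omega>) (suffix_signs h T) \<le> - (2 * real n powr (3 / 2))}) \<le> exp (- real n)"
    (is "prob (\<Union>T\<in>_. ?B T) \<le> _")
proof -
  have "prob (\<Union>T\<in>Pow {1..n}. ?B T) \<le> (\<Sum>T\<in>Pow {1..n}. prob (?B T))"
    using measurable_quad_form by (intro finite_measure_subadditive_finite) auto
  also have "\<dots> \<le> (\<Sum>T\<in>Pow {1..n}. exp (- (2\<^sup>2 * real n / 2)))"
    using n by (intro sum_mono prob_quad_form_le abs_suffix_signs_le) auto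
  also have "\<dots> = 2 ^ n * exp (- 2 * real n)" by (simp add: card_Pow)
  also have "\<dots> \<le> exp 1 ^ n * exp (- 2 * real n)"
    using exp_ge_add_one_self[of 1] by (intro mult_right_mono power_mono) auto
  also have "\<dots> = exp (- real n)" by (simp flip: exp_of_nat_mult exp_add)
  finally show ?thesis .
qed

text \<open>These are the only properties of the array used by the deterministic estimates, and they
  do not involve \<open>p\<close>.\<close>

definition good :: "nat \<Rightarrow> 'a \<Rightarrow> bool" where
  "good n \<omega> \<longleftrightarrow>
    (\<forall>k\<in>{1..n}. (\<Sum>j\<in>{1..n}. (g k j \<omega>)\<^sup>2) \<le> 12 * real n \<and> (\<Sum>j\<in>{1..n}. (g j k \<omega>)\<^sup>2) \<le> 12 * real n) \<and>
    (\<exists>y. (\<forall>i. \<bar>y i\<bar> \<le> 1) \<and> 1 / 2 ^ 20 * real n powr (3 / 2) \<le> quad_form n (\<lambda>i j. g i j \<omega>) y)"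

text \<open>Failure is enclosed in a measurable event, which avoids asking whether
  \<open>good\<close>, with its quantifier over all \<open>y\<close>, is itself measurable.\<close>

lemma exists_bad_event:
  "\<exists>B\<in>sets M. prob B \<le> 5 * exp (- (real n / 2 ^ 41)) \<and> (\<forall>\<omega>\<in>space M - B. good n \<omega>)"
proof (cases "n \<ge> 2")
  case False
  \<comment> \<open>For \<open>n < 2\<close> the claimed bound exceeds 1, so the whole space serves
    as the bad event.\<close>
  have "1 - 1 / 2 \<le> exp (- (real n / 2 ^ 41))"
    using False exp_ge_add_one_self[of "- (real n / 2 ^ 41)"] by simp
  then show ?thesis by (intro bexI[of _ "space M"]) (auto simp: prob_space)
next
  case True
  define h where "h = n div 2"
  \<comment> \<open>With this level the first block has rate \<open>s^2 / 2 = 1 / 2 ^ 41\<close>,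
    the slowest of the four; the prefactor 5 collects 2 from \<open>R\<close> and 1 from each of the
    others.\<close>
  define s :: real where "s = 1 / 2 ^ 20"
  have h: "h \<ge> 1" "n \<le> 8 * h" "2 * h \<le> n" "n \<le> 2 * (n - h)" using True by (auto simp: h_def)
  define R where "R = (\<Union>k\<in>{1..n}. {\<omega> \<in> space M. 12 * real n \<le> (\<Sum>j\<in>{1..n}. (g k j \<omega>)\<^sup>2)} \<union>
      {\<omega> \<in> space M. 12 * real n \<le> (\<Sum>j\<in>{1..n}. (g j k \<omega>)\<^sup>2)})"
  define B1 where "B1 = {\<omega> \<in> space M.
    quad_form n (\<lambda>i j. g i j \<omega>) (prefix_vec h) \<le> - (s * real n powr (3 / 2))}"
  define B2 where "B2 = (\<Union>T\<in>Pow {1..n}. {\<omega> \<in> space M.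
    quad_form n (\<lambda>i j. g i j \<omega>) (suffix_signs h T) \<le> - (2 * real n powr (3 / 2))})"
  define B3 where "B3 = {\<omega> \<in> space M. (\<Sum>i\<in>{h + 1..n}. \<bar>\<Sum>j\<in>{1..h}. g i j \<omega> + g j i \<omega>\<bar>) \<le>
    sqrt (2 * real h) * real (n - h) / 64}"
  have sets: "R \<in> sets M" "B1 \<in> sets M" "B2 \<in> sets M" "B3 \<in> sets M"
    unfolding R_def B1_def B2_def B3_def
    by (intro sets.finite_UN sets.Un borel_measurable_le borel_measurable_sum borel_measurable_power
        borel_measurable_add borel_measurable_abs borel_measurable_const measurable_quad_form
        measurable_entry; use h in simp)+
  have mono: "exp (- a) \<le> exp (- (real n / 2 ^ 41))" if "real n / 2 ^ 41 \<le> a" for a :: real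
    using that by simp
  have "prob R \<le> 2 * exp (- real n)" unfolding R_def by (rule prob_row_or_column_large)
  moreover have "prob B1 \<le> exp (- (s\<^sup>2 * real n / 2))"
    unfolding B1_def using True by (intro prob_quad_form_le abs_prefix_vec_le) (auto simp: s_def)
  moreover have "prob B2 \<le> exp (- real n)"
    unfolding B2_def using True by (intro prob_suffix_quad_form_small) simp
  moreover have "prob B3 \<le> exp (- real (n - h))"
    unfolding B3_def by (rule prob_cross_sum_le[OF h(1)])
  moreover have "exp (- (s\<^sup>2 * real n / 2)) \<le> exp (- (real n / 2 ^ 41))"
    by (rule mono) (simp add: s_def power2_eq_square)
  moreover have "exp (- real n) \<le> exp (- (real n / 2 ^ 41))" by (rule mono) simp
  moreover have "exp (- real (n - h)) \<le> exp (- (real n / 2 ^ 41))"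
  proof (rule mono)
    have "real n \<le> real (2 * (n - h))" using h(4) by (simp only: of_nat_le_iff)
    then show "real n / 2 ^ 41 \<le> real (n - h)" by simp
  qed
  moreover have "prob (R \<union> B1 \<union> B2 \<union> B3) \<le> prob R + prob B1 + prob B2 + prob B3"
    using measure_Un_le[of R M B1] measure_Un_le[of "R \<union> B1" M B2]
      measure_Un_le[of "R \<union> B1 \<union> B2" M B3] sets by (simp add: sets.Un)
  ultimately have "prob (R \<union> B1 \<union> B2 \<union> B3) \<le> 5 * exp (- (real n / 2 ^ 41))" by linarith
  moreover have "good n \<omega>" if "\<omega> \<in> space M - (R \<union> B1 \<union> B2 \<union> B3)" for \<omega>
  proof -
    have "\<exists>y. (\<forall>i. \<bar>y i\<bar> \<le> 1) \<and> 1 / 2 ^ 20 * real n powr (3 / 2) \<le> quad_form n (\<lambda>i j. g i j \<omega>) y"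
    proof (rule exists_large_quad_form[OF h(2,3)])
      show "- (1 / 2 ^ 20 * real n powr (3 / 2)) \<le> quad_form n (\<lambda>i j. g i j \<omega>) (prefix_vec h)"
        using that by (auto simp: B1_def s_def)
      show "- (2 * real n powr (3 / 2)) \<le> quad_form n (\<lambda>i j. g i j \<omega>) (suffix_signs h T)"
        if "T \<subseteq> {1..n}" for T
      proof -
        have "\<not> quad_form n (\<lambda>i j. g i j \<omega>) (suffix_signs h T) \<le> - (2 * real n powr (3 / 2))"
          using that \<open>\<omega> \<in> space M - (R \<union> B1 \<union> B2 \<union> B3)\<close> unfolding B2_def by blast
        then show ?thesis by linarith
      qed
      show "sqrt (2 * real h) * real (n - h) / 64 \<le>
          (\<Sum>i\<in>{h + 1..n}. \<bar>\<Sum>j\<in>{1..h}. g i j \<omega> + g j i \<omega>\<bar>)"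
        using that by (auto simp: B3_def)
    qed
    then show ?thesis using that unfolding good_def R_def by force
  qed
  ultimately show ?thesis using sets by (intro bexI[of _ "R \<union> B1 \<union> B2 \<union> B3"]) auto
qed

end

section \<open>Convergence and delocalization\<close>

theorem theorem1p6:
  fixes M :: "'a measure" and g :: "nat \<Rightarrow> nat \<Rightarrow> 'a \<Rightarrow> real"
    and p :: real and L :: "real \<Rightarrow> real"
  assumes "prob_space M"
    and "prob_space.indep_vars M (\<lambda>_. borel) (\<lambda>(i, j). g i j) ({1..} \<times> {1..})"
    and "\<And>i j. i \<ge> 1 \<Longrightarrow> j \<ge> 1 \<Longrightarrow> distributed M lborel (g i j) std_normal_density"
    and "2 < p"
    and "AE \<omega> in M. \<forall>t>0. (\<lambda>n. Lmax n p t (\<lambda>i j. g i j \<omega>)) \<longlonglongrightarrow> L t"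
  shows "(\<exists>GPp::real.
           (AE \<omega> in M. (\<lambda>n. GP n p (\<lambda>i j. g i j \<omega>)) \<longlonglongrightarrow> GPp) \<and>
           (\<forall>t>0. GPp = p / 2 * (p / 2 - 1) powr (2 / p - 1) * t powr (2 / p)
                          * L t powr (1 - 2 / p))) \<and>
         (let \<delta> = p / 2 - 1 in
           \<exists>C>0. \<exists>C'>0. \<forall>n\<ge>1.
             measure M {\<omega> \<in> space M. \<forall>x. GP_optimizer n p (\<lambda>i j. g i j \<omega>) x \<longrightarrow>
                 linf_norm n x \<le> C * real n powr (1 / (p + \<delta>) - 1 / p)}
               \<ge> 1 - C' * exp (- real n / C'))"
proof -
  have p0: "p > 0" and p2: "p > 2" using assms(4) by auto
  interpret gaussian_array M g
    using assms(1,2,3) by (intro gaussian_array.intro gaussian_array_axioms.intro)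
  define G where "G \<omega> = (\<lambda>i j. g i j \<omega>)" for \<omega>
  define c :: real where "c = 1 / 2 ^ 20"
  have c: "c > 0" by (simp add: c_def)
  obtain B where B: "\<And>n. B n \<in> sets M" "\<And>n. prob (B n) \<le> 5 * exp (- (real n / 2 ^ 41))"
    "\<And>n \<omega>. \<omega> \<in> space M - B n \<Longrightarrow> good n \<omega>"
    using exists_bad_event by metis
  have GP: "c \<le> GP n p (G \<omega>)" if "n \<ge> 1" "good n \<omega>" for n \<omega>
    using that(2) GP_ge_of_vector[OF that(1) p0 c, of _ "G \<omega>"] unfolding good_def G_def c_def by blast

  define F where "F t l = p / 2 * (p / 2 - 1) powr (2 / p - 1) * t powr (2 / p) * l powr (1 - 2 / p)"
    for t l :: real
  \<comment> \<open>Summable failure probabilities give, by Borel-Cantelli, that almost every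
    outcome is good for all large \<open>n\<close>.\<close>
  have "summable (\<lambda>n. prob (B n))"
  proof (rule summable_comparison_test)
    have "5 * exp (- (real n / 2 ^ 41)) = 5 * exp (- (1 / 2 ^ 41)) ^ n" for n
      by (simp flip: exp_of_nat_mult)
    then show "\<exists>N. \<forall>n\<ge>N. norm (prob (B n)) \<le> 5 * exp (- (1 / 2 ^ 41)) ^ n"
      using B(2) by (metis measure_nonneg norm_of_real real_norm_def abs_of_nonneg)
    show "summable (\<lambda>n. 5 * exp (- (1 / 2 ^ 41)) ^ n :: real)"
      by (intro summable_mult summable_geometric) simp
  qed
  then have "AE \<omega> in M. eventually (\<lambda>n. \<omega> \<in> space M - B n) sequentially"
    using B(1) by (intro borel_cantelli_AE1) (auto simp: emeasure_eq_measure)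
  then have "AE \<omega> in M. \<forall>t>0. (\<lambda>n. GP n p (G \<omega>)) \<longlonglongrightarrow> F t (L t)"
    using assms(5)
  proof eventually_elim
    case (elim \<omega>)
    have "\<forall>\<^sub>F n in sequentially. GP n p (G \<omega>) \<ge> 0 \<and> n \<ge> 1"
      using elim(1) eventually_ge_at_top[of 1]
    proof eventually_elim
      case (elim n)
      then show ?case using GP[OF _ B(3)] c by fastforce
    qed
    note ev = this
    show ?case
    proof (intro allI impI)
      fix t :: real assume t: "t > 0"
      \<comment> \<open>The limit \<open>L t\<close> has not been shown to be positive. Eventual
        nonnegativity together with the positive exponent \<open>1 - 2 / p\<close> still allows the
        limit to pass through \<open>powr\<close>.\<close>
      have "\<forall>\<^sub>F n in sequentially. Lmax n p t (G \<omega>) \<ge> 0"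
        using ev by eventually_elim (use Lmax_eq_GP[OF _ p2 t] p2 in simp)
      moreover have "(\<lambda>n. Lmax n p t (G \<omega>)) \<longlonglongrightarrow> L t" using elim(2) t by (simp add: G_def)
      ultimately have "(\<lambda>n. F t (Lmax n p t (G \<omega>))) \<longlonglongrightarrow> F t (L t)"
        unfolding F_def using p2 by (intro tendsto_mult tendsto_const tendsto_powr') auto
      moreover have "\<forall>\<^sub>F n in sequentially. F t (Lmax n p t (G \<omega>)) = GP n p (G \<omega>)"
        using ev by eventually_elim (use GP_eq_Lmax[OF _ p2 t] in \<open>simp add: F_def\<close>)
      ultimately show "(\<lambda>n. GP n p (G \<omega>)) \<longlonglongrightarrow> F t (L t)" by (rule Lim_transform_eventually)
    qed
  qed
  note lim = this
  \<comment> \<open>The values \<open>F t (L t)\<close> are deterministic, so a single outcome from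
    the almost sure event suffices to compare them for different \<open>t\<close>.\<close>
  have "\<exists>\<omega>. \<forall>t>0. (\<lambda>n. GP n p (G \<omega>)) \<longlonglongrightarrow> F t (L t)"
  proof (rule ccontr)
    assume "\<nexists>\<omega>. \<forall>t>0. (\<lambda>n. GP n p (G \<omega>)) \<longlonglongrightarrow> F t (L t)"
    then have "AE \<omega> in M. False" by (intro eventually_mono[OF lim]) blast
    then show False by simp
  qed
  then have "F 1 (L 1) = F t (L t)" if "t > 0" for t
    using that LIMSEQ_unique zero_less_one by blast
  then have part1: "\<exists>GPp. (AE \<omega> in M. (\<lambda>n. GP n p (G \<omega>)) \<longlonglongrightarrow> GPp) \<and> (\<forall>t>0. GPp = F t (L t))"
    using lim by (intro exI[of _ "F 1 (L 1)"]) (auto elim: eventually_mono)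

  define C where "C = (3 * p * sqrt 12 / (2 * c)) powr (1 / (p - 1))"
  define e where "e = 1 / (p + (p / 2 - 1)) - 1 / p"
  \<comment> \<open>The number \<open>2 ^ 41\<close> acts both as inverse rate and as prefactor,
    being larger than 5, because the statement uses one constant for the two.\<close>
  have part2: "measure M {\<omega> \<in> space M. \<forall>x. GP_optimizer n p (G \<omega>) x \<longrightarrow> linf_norm n x \<le> C * real n powr e}
      \<ge> 1 - 2 ^ 41 * exp (- real n / 2 ^ 41)" (is "prob ?A \<ge> _") if n: "n \<ge> 1" for n
  proof -
    have "1 - 2 ^ 41 * exp (- real n / 2 ^ 41) \<le> 1 - 5 * exp (- (real n / 2 ^ 41))"
      by simp
    also have "\<dots> \<le> prob (space M - B n)" using B(1,2)[of n] by (simp add: prob_compl)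
    also have "\<dots> \<le> prob ?A"
    proof (rule finite_measure_mono)
      show "?A \<in> sets M"
        unfolding G_def by (intro sets_GP_optimizer_linf n p0 measurable_entry)
      show "space M - B n \<subseteq> ?A"
      proof
        fix \<omega> assume \<omega>: "\<omega> \<in> space M - B n"
        then have good: "good n \<omega>" by (rule B(3))
        have "linf_norm n x \<le> C * real n powr e" if "GP_optimizer n p (G \<omega>) x" for x
          unfolding C_def e_def
        proof (rule GP_optimizer_linf_le[OF n p2 c _ _ _ GP[OF n good] that])
          fix k assume "k \<in> {1..n}"
          then show "(\<Sum>j\<in>{1..n}. (G \<omega> k j)\<^sup>2) \<le> 12 * real n" "(\<Sum>j\<in>{1..n}. (G \<omega> j k)\<^sup>2) \<le> 12 * real n"
            using good unfolding good_def G_def by blast+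
        qed simp
        then show "\<omega> \<in> ?A" using \<omega> by blast
      qed
    qed
    finally show ?thesis .
  qed
  have "C > 0" using p2 c by (simp add: C_def)
  then have "\<exists>C>0. \<exists>C'>0. \<forall>n\<ge>1. measure M {\<omega> \<in> space M. \<forall>x. GP_optimizer n p (G \<omega>) x \<longrightarrow>
      linf_norm n x \<le> C * real n powr e} \<ge> 1 - C' * exp (- real n / C')"
    using part2 by (intro exI[of _ C] conjI exI[of _ "2 ^ 41 :: real"]) auto
  with part1 show ?thesis unfolding Let_def F_def G_def e_def by (rule conjI)
qed

end
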